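(* Let $G$ be an abelian group and $\underline{g}=(g_1,\dots,g_m)\in G^m$. Let $\mathcal{A}(\mathcal{B}(\mathrm{supp}(\underline{g})))=\{a_1,\dots,a_n\}$ with $|a_1|\ge|a_2|\ge\cdots\ge|a_n|$, and $r=r(\mathcal{B}(\mathrm{supp}(\underline{g})))$. Then: (i) $c_{\mathrm{gr}}(\mathcal{B}(\underline{g}))\le\max\{2|a_1|,\ c_{\mathrm{gr}}(\mathcal{B}(\mathrm{supp}(\underline{g})))\}$ and $c_{\mathrm{gr}}(\mathcal{B}(\mathrm{supp}(\underline{g})))\le\sum_{i=1}^{\min\{n,r+1\}}|a_i|-r$; (ii) if $g_1,\dots,g_m$ generate a finite subgroup of $G$, then $c_{\mathrm{gr}}(\mathcal{B}(\underline{g}))\le2\,\mathsf{d}(\mathrm{supp}(\underline{g}))+2$.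
   Context: $G$ is written multiplicatively. $\mathcal{B}(\underline{g})=\{\alpha\in\mathbb{N}_0^m\mid\prod_ig_i^{\alpha_i}=1\}$, $\mathrm{supp}(\underline{g})=\{g_1,\dots,g_m\}$, and for finite $G_0\subseteq G$, $\mathcal{B}(G_0)=\{\alpha\in\mathbb{N}_0^{G_0}\mid\prod_{g\in G_0}g^{\alpha(g)}=1\}$. These monoids are graded by total degree $|\alpha|=\sum\alpha_i$ (resp. $\sum_g\alpha(g)$); they are connected graded reduced affine monoids with finite atom sets $\mathcal{A}(\cdot)$. For such a monoid $T$ (written additively): for $\alpha,\gamma\in\mathbb{N}_0^{\mathcal{A}(T)}$ let $a^{\alpha}=\sum_a\alpha(a)a\in T$, $|\alpha|_{\mathrm{gr}}=\sum_a\alpha(a)|a|$, $\gcd(\alpha,\gamma)(a)=\min\{\alpha(a),\gamma(a)\}$, $d_{\mathrm{gr}}(\alpha,\gamma)=\max\{|\alpha-\gcd|_{\mathrm{gr}},|\gamma-\gcd|_{\mathrm{gr}}\}$; the graded catenary degree $c_{\mathrm{gr}}(T)$ is the minimal $d$ such that whenever $a^{\alpha}=a^{\gamma}$ there is a sequence $\alpha=\alpha^{(0)},\dots,\alpha^{(k)}=\gamma$ with $a^{\alpha^{(j)}}=a^{\alpha^{(j+1)}}$ and $d_{\mathrm{gr}}(\alpha^{(j)},\alpha^{(j+1)})\le d$. $r(T)$ is the rank of the subgroup of the ambient free abelian group $\mathbb{Z}^{\mathrm{supp}(\underline{g})}$ generated by $T$. For a finite subset $G_0$ of a finite abelian group,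 the little Davenport constant $\mathsf{d}(G_0)$ is the maximal $|\alpha|$, $\alpha\in\mathbb{N}_0^{G_0}$, such that for every atom $\gamma$ of $\mathcal{B}(G_0)$ there is $g\in G_0$ with $\gamma(g)>\alpha(g)$ (the maximal length of a sequence over $G_0$ with no nonempty product-one subsequence). *)

theory Defs
  imports Main
begin

text \<open>The abelian group G is modelled by a type of class ab_group_add, written
additively: products become sums, powers g^k become k-fold sums.\<close>

definition npow :: "nat \<Rightarrow> 'a::ab_group_add \<Rightarrow> 'a" where
  "npow k x = (\<Sum>_\<in>{..<k}. x)"

inductive_set gen_subgroup :: "'a::ab_group_add set \<Rightarrow> 'a set" for S where
  gen_zero: "0 \<in> gen_subgroup S"
| gen_base: "s \<in> S \<Longrightarrow> s \<in> gen_subgroup S"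
| gen_neg: "x \<in> gen_subgroup S \<Longrightarrow> - x \<in> gen_subgroup S"
| gen_add: "x \<in> gen_subgroup S \<Longrightarrow> y \<in> gen_subgroup S \<Longrightarrow> x + y \<in> gen_subgroup S"

definition Bseq :: "(nat \<Rightarrow> 'a::ab_group_add) \<Rightarrow> nat \<Rightarrow> (nat \<Rightarrow> nat) set" where
  "Bseq g m = {\<alpha>. (\<forall>i. m \<le> i \<longrightarrow> \<alpha> i = 0) \<and> (\<Sum>i<m. npow (\<alpha> i) (g i)) = 0}"

definition Bset :: "'a::ab_group_add set \<Rightarrow> ('a \<Rightarrow> nat) set" where
  "Bset G0 = {\<alpha>. (\<forall>x. x \<notin> G0 \<longrightarrow> \<alpha> x = 0) \<and> (\<Sum>x\<in>G0. npow (\<alpha> x) x) = 0}"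

text \<open>Generic notions for a submonoid T of N_0^I (elements vanish outside I).\<close>
definition deg :: "'i set \<Rightarrow> ('i \<Rightarrow> nat) \<Rightarrow> nat" where
  "deg I \<alpha> = (\<Sum>i\<in>I. \<alpha> i)"

definition atoms :: "('i \<Rightarrow> nat) set \<Rightarrow> ('i \<Rightarrow> nat) set" where
  "atoms T = {a \<in> T. a \<noteq> (\<lambda>_. 0) \<and>
     (\<forall>b c. b \<in> T \<longrightarrow> c \<in> T \<longrightarrow> a = (\<lambda>i. b i + c i) \<longrightarrow> b = (\<lambda>_. 0) \<or> c = (\<lambda>_. 0))}"

text \<open>Factorizations: elements of N_0^{A(T)}, i.e. functions on elements vanishing outside the atoms.\<close>
definition is_fact :: "('i \<Rightarrow> nat) set \<Rightarrow> (('i \<Rightarrow> nat) \<Rightarrow> nat) \<Rightarrow> bool" where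
  "is_fact T \<phi> \<longleftrightarrow> (\<forall>a. a \<notin> atoms T \<longrightarrow> \<phi> a = 0)"

definition fval :: "('i \<Rightarrow> nat) set \<Rightarrow> (('i \<Rightarrow> nat) \<Rightarrow> nat) \<Rightarrow> ('i \<Rightarrow> nat)" where
  "fval T \<phi> = (\<lambda>i. \<Sum>a\<in>atoms T. \<phi> a * a i)"

definition gdeg :: "'i set \<Rightarrow> ('i \<Rightarrow> nat) set \<Rightarrow> (('i \<Rightarrow> nat) \<Rightarrow> nat) \<Rightarrow> nat" where
  "gdeg I T \<phi> = (\<Sum>a\<in>atoms T. \<phi> a * deg I a)"

definition dgr :: "'i set \<Rightarrow> ('i \<Rightarrow> nat) set \<Rightarrow> (('i \<Rightarrow> nat) \<Rightarrow> nat) \<Rightarrow> (('i \<Rightarrow> nat) \<Rightarrow> nat) \<Rightarrow> nat" where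
  "dgr I T \<phi> \<psi> = max (gdeg I T (\<lambda>a. \<phi> a - min (\<phi> a) (\<psi> a)))
                        (gdeg I T (\<lambda>a. \<psi> a - min (\<phi> a) (\<psi> a)))"

definition cgr :: "'i set \<Rightarrow> ('i \<Rightarrow> nat) set \<Rightarrow> nat" where
  "cgr I T = (LEAST d. \<forall>\<phi> \<psi>. is_fact T \<phi> \<longrightarrow> is_fact T \<psi> \<longrightarrow> fval T \<phi> = fval T \<psi> \<longrightarrow>
      (\<exists>k f. f 0 = \<phi> \<and> f k = \<psi> \<and> (\<forall>j\<le>k. is_fact T (f j)) \<and>
         (\<forall>j<k. fval T (f j) = fval T (f (Suc j)) \<and> dgr I T (f j) (f (Suc j)) \<le> d)))"

definition zspan :: "('i \<Rightarrow> nat) set \<Rightarrow> ('i \<Rightarrow> int) set" where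
  "zspan T = {v. \<exists>F c. finite F \<and> F \<subseteq> T \<and> v = (\<lambda>i. \<Sum>t\<in>F. c t * int (t i))}"

definition z_indep :: "('i \<Rightarrow> int) set \<Rightarrow> bool" where
  "z_indep S \<longleftrightarrow> (\<forall>c. (\<lambda>i. \<Sum>s\<in>S. c s * s i) = (\<lambda>_. 0) \<longrightarrow> (\<forall>s\<in>S. c s = 0))"

definition mrank :: "('i \<Rightarrow> nat) set \<Rightarrow> nat" where
  "mrank T = Max {card S | S. finite S \<and> S \<subseteq> zspan T \<and> z_indep S}"

definition davenport :: "'a::ab_group_add set \<Rightarrow> nat" where
  "davenport G0 = Max {deg G0 \<alpha> | \<alpha>. (\<forall>x. x \<notin> G0 \<longrightarrow> \<alpha> x = 0) \<and>
       (\<forall>\<gamma>\<in>atoms (Bset G0). \<exists>x\<in>G0. \<alpha> x < \<gamma> x)}"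

end

theory Submission
  imports Complex_Main Defs  (* in this order, so that Bseq is not the abbreviation from Limits *)
begin

text \<open>Call two atoms of a saturated submonoid \<open>T\<close> of \<open>N_0^I\<close> compatible below \<open>\<beta>\<close> if their sum
  is at most \<open>\<beta>\<close>. The graded catenary degree is at most \<open>d\<close> iff for every \<open>\<beta> \<in> T\<close> of degree
  exceeding \<open>d\<close> the compatibility graph on the atoms below \<open>\<beta>\<close> is connected.

  For (ii), let \<open>D\<close> be one more than the little Davenport constant, so that everything of degree at
  least \<open>D\<close> dominates an atom, and let \<open>\<beta>\<close> have degree above \<open>2D\<close>. A join of two atoms whose degree
  is at most \<open>D + 1\<close> leaves room for a third atom compatible with both, and any two atoms are linked through such joins. For the first half of (i),
  paths for \<open>B(supp g)\<close> lift to \<open>B(g)\<close>, and two atoms with the same image are linked by moving one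
  unit at a time.

  For the rank bound, consider the polytope of real \<open>q \<ge> 0\<close> with \<open>\<Sum> q\<^sub>a a = \<beta>\<close>. The atoms with
  \<open>q\<^sub>a \<ge> 1\<close> are pairwise compatible. A point of an edge is supported on a set \<open>F\<close> of at most
  \<open>r + 1\<close> atoms; if all its coordinates were below 1, then \<open>\<Sum>\<^sub>F a - \<beta>\<close> would be positive on the
  support of \<open>F\<close>, which makes the degree of \<open>\<beta>\<close> too small. So every point of the 1-skeleton
  determines a component of the graph, constant along edges, and a simplex walk from one
  factorization to another shows that there is only one.\<close>

section \<open>Chains of factorizations and connectedness of divisors\<close>

definition chainable :: "'i set \<Rightarrow> ('i \<Rightarrow> nat) set \<Rightarrow> nat \<Rightarrow> bool" where
  "chainable I T d \<longleftrightarrow> (\<forall>\<phi> \<psi>. is_fact T \<phi> \<longrightarrow> is_fact T \<psi> \<longrightarrow> fval T \<phi> = fval T \<psi> \<longrightarrow>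
      (\<exists>k f. f 0 = \<phi> \<and> f k = \<psi> \<and> (\<forall>j\<le>k. is_fact T (f j)) \<and>
         (\<forall>j<k. fval T (f j) = fval T (f (Suc j)) \<and> dgr I T (f j) (f (Suc j)) \<le> d)))"

lemma cgr_eq_Least: "cgr I T = (LEAST d. chainable I T d)"
  unfolding cgr_def chainable_def ..

lemma cgr_le: "chainable I T d \<Longrightarrow> cgr I T \<le> d"
  unfolding cgr_eq_Least by (rule Least_le)

text \<open>\<open>LEAST\<close> over an empty predicate is unspecified, so \<open>cgr\<close> is
  known to have its defining property only once some chainable bound has been produced.\<close>

lemma chainable_cgr: "chainable I T d \<Longrightarrow> chainable I T (cgr I T)"
  unfolding cgr_eq_Least by (rule LeastI)

definition step :: "'i set \<Rightarrow> ('i \<Rightarrow> nat) set \<Rightarrow> nat \<Rightarrow> (('i \<Rightarrow> nat) \<Rightarrow> nat) \<Rightarrow> (('i \<Rightarrow> nat) \<Rightarrow> nat) \<Rightarrow> bool"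
  where "step I T d \<phi> \<psi> \<longleftrightarrow> is_fact T \<phi> \<and> is_fact T \<psi> \<and> fval T \<phi> = fval T \<psi> \<and> dgr I T \<phi> \<psi> \<le> d"

text \<open>Chains are built as reflexive transitive closures of \<open>step\<close>, which compose
  freely; the indexed sequence required by \<open>chainable\<close> is extracted here once.\<close>

lemma chainableI:
  assumes "\<And>\<phi> \<psi>. is_fact T \<phi> \<Longrightarrow> is_fact T \<psi> \<Longrightarrow> fval T \<phi> = fval T \<psi> \<Longrightarrow> (step I T d)\<^sup>*\<^sup>* \<phi> \<psi>"
  shows "chainable I T d"
  unfolding chainable_def
proof (intro allI impI)
  fix \<phi> \<psi> assume *: "is_fact T \<phi>" "is_fact T \<psi>" "fval T \<phi> = fval T \<psi>"
  from assms[OF this] obtain k where "(step I T d ^^ k) \<phi> \<psi>"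
    using rtranclp_imp_relpowp by metis
  then obtain f where f: "f 0 = \<phi>" "f k = \<psi>" "\<And>i. i < k \<Longrightarrow> step I T d (f i) (f (Suc i))"
    unfolding relpowp_fun_conv by blast
  have "is_fact T (f j)" if "j \<le> k" for j
    using that f * by (cases "j = k") (auto simp: step_def)
  with f show "\<exists>k f. f 0 = \<phi> \<and> f k = \<psi> \<and> (\<forall>j\<le>k. is_fact T (f j)) \<and>
         (\<forall>j<k. fval T (f j) = fval T (f (Suc j)) \<and> dgr I T (f j) (f (Suc j)) \<le> d)"
    by (intro exI[of _ k] exI[of _ f]) (auto simp: step_def)
qed

text \<open>For \<beta> in a saturated T this means that a and b occur together in one factorization
  of \<beta>, with multiplicity at least two if a = b.\<close>

definition compatible :: "('i \<Rightarrow> nat) set \<Rightarrow> ('i \<Rightarrow> nat) \<Rightarrow> ('i \<Rightarrow> nat) \<Rightarrow> ('i \<Rightarrow> nat) \<Rightarrow> bool" where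
  "compatible T \<beta> a b \<longleftrightarrow> a \<in> atoms T \<and> b \<in> atoms T \<and> (\<forall>i. a i + b i \<le> \<beta> i)"

definition divisors_connected :: "('i \<Rightarrow> nat) set \<Rightarrow> ('i \<Rightarrow> nat) \<Rightarrow> bool" where
  "divisors_connected T \<beta> \<longleftrightarrow>
     (\<forall>a\<in>atoms T. \<forall>b\<in>atoms T. a \<le> \<beta> \<longrightarrow> b \<le> \<beta> \<longrightarrow> (compatible T \<beta>)\<^sup>*\<^sup>* a b)"

lemma deg_add: "deg I (\<lambda>i. a i + b i) = deg I a + deg I b"
  by (simp add: deg_def sum.distrib)

lemma deg_mono: "a \<le> b \<Longrightarrow> deg I a \<le> deg I b"
  by (auto simp: deg_def le_fun_def intro: sum_mono)

lemma deg_diff: "a \<le> b \<Longrightarrow> deg I (\<lambda>i. b i - a i) = deg I b - deg I a"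
  by (simp add: deg_def le_fun_def sum_subtractf_nat)

lemma finite_bounded_deg:
  assumes "finite I"
  shows "finite {\<alpha>. (\<forall>i. i \<notin> I \<longrightarrow> \<alpha> i = 0) \<and> deg I \<alpha> \<le> D}"
proof (rule finite_subset)
  show "{\<alpha>. (\<forall>i. i \<notin> I \<longrightarrow> \<alpha> i = 0) \<and> deg I \<alpha> \<le> D}
     \<subseteq> {\<alpha>. \<forall>i. (i \<in> I \<longrightarrow> \<alpha> i \<in> {..D}) \<and> (i \<notin> I \<longrightarrow> \<alpha> i = 0)}"
  proof clarsimp
    fix \<alpha> i assume "deg I \<alpha> \<le> D" "i \<in> I"
    with member_le_sum[of i I \<alpha>] assms show "\<alpha> i \<le> D" by (auto simp: deg_def)
  qed
qed (intro finite_set_of_finite_funs assms finite_atMost)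

lemma atoms_subset: "atoms T \<subseteq> T"
  by (auto simp: atoms_def)

lemma atom_nonzero: "a \<in> atoms T \<Longrightarrow> a \<noteq> (\<lambda>_. 0)"
  by (auto simp: atoms_def)

section \<open>Saturated submonoids and their factorizations\<close>

locale saturated_monoid =
  fixes I :: "'i set" and T :: "('i \<Rightarrow> nat) set"
  assumes finite_I: "finite I"
    and vanish: "t \<in> T \<Longrightarrow> i \<notin> I \<Longrightarrow> t i = 0"
    and zero_mem: "(\<lambda>_. 0) \<in> T"
    and add_mem: "s \<in> T \<Longrightarrow> t \<in> T \<Longrightarrow> (\<lambda>i. s i + t i) \<in> T"
    and diff_mem: "s \<in> T \<Longrightarrow> t \<in> T \<Longrightarrow> s \<le> t \<Longrightarrow> (\<lambda>i. t i - s i) \<in> T"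
    and finite_atoms: "finite (atoms T)"
begin

lemma deg_pos: "t \<in> T \<Longrightarrow> t \<noteq> (\<lambda>_. 0) \<Longrightarrow> 0 < deg I t"
  unfolding deg_def neq0_conv[symmetric] sum_eq_0_iff[OF finite_I] using vanish by blast

lemma atom_deg_pos: "a \<in> atoms T \<Longrightarrow> 0 < deg I a"
  using deg_pos atom_nonzero atoms_subset by blast

text \<open>Graded length is determined by the value alone, so two factorizations of \<beta> without
  a common atom have distance exactly deg \<beta>.\<close>

lemma gdeg_eq: "gdeg I T \<phi> = deg I (fval T \<phi>)"
  unfolding gdeg_def deg_def fval_def by (subst sum.swap) (simp add: sum_distrib_left)

lemma fval_upd:
  assumes "c \<in> atoms T"
  shows "fval T (\<phi>(c := Suc (\<phi> c))) i = fval T \<phi> i + c i"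
  unfolding fval_def using assms finite_atoms
  by (simp add: sum.remove[of "atoms T" c])

lemma is_fact_upd: "is_fact T \<phi> \<Longrightarrow> c \<in> atoms T \<Longrightarrow> is_fact T (\<phi>(c := k))"
  by (auto simp: is_fact_def)

lemma fact_exists:
  assumes "t \<in> T" shows "\<exists>\<phi>. is_fact T \<phi> \<and> fval T \<phi> = t"
  using assms
proof (induction "deg I t" arbitrary: t rule: less_induct)
  case less
  have z: "is_fact T (\<lambda>_. 0)" "fval T (\<lambda>_. 0) = (\<lambda>_. 0)"
    by (auto simp: is_fact_def fval_def)
  consider "t = (\<lambda>_. 0)" | "t \<in> atoms T" | "t \<noteq> (\<lambda>_. 0)" "t \<notin> atoms T" by blast
  then show ?case
  proof cases
    case 1
    then show ?thesis using z by blast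
  next
    case 2
    have "fval T ((\<lambda>_. 0)(t := Suc 0)) = t"
      using fval_upd[OF 2, of "\<lambda>_. 0"] z(2) by auto
    then show ?thesis using is_fact_upd[OF z(1) 2] by blast
  next
    case 3
    with less.prems obtain b c where bc: "b \<in> T" "c \<in> T" "t = (\<lambda>i. b i + c i)"
      "b \<noteq> (\<lambda>_. 0)" "c \<noteq> (\<lambda>_. 0)" by (auto simp: atoms_def)
    have "deg I b < deg I t" "deg I c < deg I t"
      using bc deg_pos[of b] deg_pos[of c] by (auto simp: deg_add)
    then obtain \<phi> \<psi> where "is_fact T \<phi>" "fval T \<phi> = b" "is_fact T \<psi>" "fval T \<psi> = c"
      using less.hyps bc by meson
    then have "is_fact T (\<lambda>a. \<phi> a + \<psi> a) \<and> fval T (\<lambda>a. \<phi> a + \<psi> a) = t"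
      using bc(3) by (auto simp: is_fact_def fval_def sum.distrib distrib_right)
    then show ?thesis by blast
  qed
qed

lemma fact_pos_atom: "is_fact T \<phi> \<Longrightarrow> \<phi> a > 0 \<Longrightarrow> a \<in> atoms T"
  by (auto simp: is_fact_def)

lemma fact_dvd:
  assumes "is_fact T \<phi>" "\<phi> c > 0" shows "c \<le> fval T \<phi>"
proof (rule le_funI)
  fix i
  have "c i \<le> \<phi> c * c i" using assms(2) by (cases "\<phi> c") auto
  also have "\<dots> \<le> fval T \<phi> i"
    unfolding fval_def using assms finite_atoms fact_pos_atom
    by (intro member_le_sum[where f="\<lambda>a. \<phi> a * a i"]) auto
  finally show "c i \<le> fval T \<phi> i" .
qed

lemma fact_compatible:
  assumes "is_fact T \<phi>" "\<phi> c > 0" "\<phi> e > 0" "c \<noteq> e"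
  shows "compatible T (fval T \<phi>) c e"
proof -
  have at: "c \<in> atoms T" "e \<in> atoms T" using assms fact_pos_atom by auto
  have "c i + e i \<le> fval T \<phi> i" for i
  proof -
    have "c i + e i \<le> \<phi> c * c i + \<phi> e * e i"
      using assms(2,3) by (intro add_mono) auto
    also have "\<dots> = (\<Sum>a\<in>{c,e}. \<phi> a * a i)" using assms(4) by simp
    also have "\<dots> \<le> fval T \<phi> i"
      unfolding fval_def by (rule sum_mono2) (use at finite_atoms in auto)
    finally show ?thesis .
  qed
  with at show ?thesis by (auto simp: compatible_def)
qed

lemma fact_compatible_rtranclp:
  assumes "is_fact T \<phi>" "\<phi> c > 0" "\<phi> e > 0"
  shows "(compatible T (fval T \<phi>))\<^sup>*\<^sup>* c e"
  using fact_compatible[OF assms] by (cases "c = e") auto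

text \<open>Saturation enters here: pointwise c \<le> \<beta> already puts \<beta> - c into T, and c
  is added to any factorization of that difference.\<close>

lemma fact_through:
  assumes "\<beta> \<in> T" "c \<in> atoms T" "c \<le> \<beta>"
  obtains \<phi> where "is_fact T \<phi>" "fval T \<phi> = \<beta>" "\<phi> c > 0"
proof -
  have "(\<lambda>i. \<beta> i - c i) \<in> T" using assms diff_mem atoms_subset by blast
  then obtain \<phi> where "is_fact T \<phi>" "fval T \<phi> = (\<lambda>i. \<beta> i - c i)" using fact_exists by blast
  moreover then have "fval T (\<phi>(c := Suc (\<phi> c))) = \<beta>"
    using assms fval_upd[OF assms(2), of \<phi>] by (auto simp: le_fun_def)
  ultimately show thesis using that[of "\<phi>(c := Suc (\<phi> c))"] assms is_fact_upd by auto
qed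

lemma fact_through_compatible:
  assumes "\<beta> \<in> T" "compatible T \<beta> c e"
  obtains \<phi> where "is_fact T \<phi>" "fval T \<phi> = \<beta>" "\<phi> c > 0" "\<phi> e > 0"
proof -
  have at: "c \<in> atoms T" "e \<in> atoms T" and le: "\<And>i. c i + e i \<le> \<beta> i"
    using assms(2) by (auto simp: compatible_def)
  have lec: "c \<le> \<beta>" using add_leD1[OF le] by (auto simp: le_fun_def)
  have "(\<lambda>i. \<beta> i - c i) \<in> T" using assms diff_mem atoms_subset at lec by blast
  moreover have "e \<le> (\<lambda>i. \<beta> i - c i)"
    using le by (auto simp: le_fun_def) (metis add.commute le_diff_conv2 add_leD1)
  ultimately obtain \<phi> where \<phi>: "is_fact T \<phi>" "fval T \<phi> = (\<lambda>i. \<beta> i - c i)" "\<phi> e > 0"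
    using fact_through at by blast
  then have "fval T (\<phi>(c := Suc (\<phi> c))) = \<beta>"
    using lec fval_upd[OF at(1), of \<phi>] by (auto simp: le_fun_def)
  then show thesis using that[of "\<phi>(c := Suc (\<phi> c))"] \<phi> at is_fact_upd by auto
qed

lemma atom_below_at:
  assumes "t \<in> T" "t i > 0"
  obtains c where "c \<in> atoms T" "c \<le> t" "c i > 0"
proof -
  obtain \<phi> where \<phi>: "is_fact T \<phi>" "fval T \<phi> = t" using fact_exists assms by blast
  with assms have "(\<Sum>a\<in>atoms T. \<phi> a * a i) \<noteq> 0" by (auto simp: fval_def)
  then obtain a where "a \<in> atoms T" "\<phi> a * a i \<noteq> 0" by (meson sum.neutral)
  with \<phi> that[of a] fact_dvd show thesis by fastforce
qed

lemma atom_below: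
  assumes "t \<in> T" "t \<noteq> (\<lambda>_. 0)"
  obtains c where "c \<in> atoms T" "c \<le> t"
  using assms atom_below_at by (metis gr0I)

section \<open>Chains of factorizations versus paths of compatible atoms\<close>

lemma step_upd:
  assumes "step I T d \<phi> \<psi>" "c \<in> atoms T"
  shows "step I T d (\<phi>(c := Suc (\<phi> c))) (\<psi>(c := Suc (\<psi> c)))"
proof -
  let ?\<phi> = "\<phi>(c := Suc (\<phi> c))" and ?\<psi> = "\<psi>(c := Suc (\<psi> c))"
  \<comment> \<open>The added common atom is absorbed by the gcd.\<close>
  have "(\<lambda>a. ?\<phi> a - min (?\<phi> a) (?\<psi> a)) = (\<lambda>a. \<phi> a - min (\<phi> a) (\<psi> a))"
    "(\<lambda>a. ?\<psi> a - min (?\<phi> a) (?\<psi> a)) = (\<lambda>a. \<psi> a - min (\<phi> a) (\<psi> a))" by auto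
  then have "dgr I T ?\<phi> ?\<psi> = dgr I T \<phi> \<psi>" by (simp only: dgr_def)
  with assms is_fact_upd show ?thesis
    by (auto simp: step_def fval_upd[OF assms(2)] fun_eq_iff)
qed

lemma steps_upd:
  "(step I T d)\<^sup>*\<^sup>* \<phi> \<psi> \<Longrightarrow> c \<in> atoms T \<Longrightarrow>
    (step I T d)\<^sup>*\<^sup>* (\<phi>(c := Suc (\<phi> c))) (\<psi>(c := Suc (\<psi> c)))"
proof (induction rule: rtranclp_induct)
  case (step y z)
  then show ?case using step_upd[OF step.hyps(2)] by (meson rtranclp.rtrancl_into_rtrancl)
qed simp

lemma gdeg_mono: "(\<And>a. \<phi> a \<le> \<psi> a) \<Longrightarrow> gdeg I T \<phi> \<le> gdeg I T \<psi>"
  unfolding gdeg_def by (intro sum_mono mult_right_mono) auto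

text \<open>Induction on the degree. Up to degree d a single step suffices. Above d, factorizations
  sharing an atom are chained by cancelling it, and a path of compatible atoms gives successive
  factorizations in which neighbours share an atom.\<close>

lemma chainable_if_connected:
  assumes conn: "\<And>\<beta>. \<beta> \<in> T \<Longrightarrow> d < deg I \<beta> \<Longrightarrow> divisors_connected T \<beta>"
  shows "chainable I T d"
proof (rule chainableI)
  fix \<phi> \<psi> assume "is_fact T \<phi>" "is_fact T \<psi>" "fval T \<phi> = fval T \<psi>"
  then show "(step I T d)\<^sup>*\<^sup>* \<phi> \<psi>"
  proof (induction "deg I (fval T \<phi>)" arbitrary: \<phi> \<psi> rule: less_induct)
    case less
    note \<phi> = less.prems(1)
    define \<beta> where "\<beta> = fval T \<phi>"
    show ?case
    proof (cases "deg I \<beta> \<le> d")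
      case True
      have "gdeg I T (\<lambda>a. \<phi> a - min (\<phi> a) (\<psi> a)) \<le> d" "gdeg I T (\<lambda>a. \<psi> a - min (\<phi> a) (\<psi> a)) \<le> d"
        using True gdeg_mono[of "\<lambda>a. \<phi> a - min (\<phi> a) (\<psi> a)" \<phi>]
          gdeg_mono[of "\<lambda>a. \<psi> a - min (\<phi> a) (\<psi> a)" \<psi>] less.prems(3)
        by (auto simp: gdeg_eq \<beta>_def)
      then show ?thesis using less.prems by (auto simp: step_def dgr_def)
    next
      case False
      have share: "(step I T d)\<^sup>*\<^sup>* \<phi>' \<psi>'"
        if f: "is_fact T \<phi>'" "is_fact T \<psi>'" "fval T \<phi>' = \<beta>" "fval T \<psi>' = \<beta>" and c: "\<phi>' c > 0" "\<psi>' c > 0"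
        for \<phi>' \<psi>' c
      proof -
        define \<phi>1 where "\<phi>1 = \<phi>'(c := \<phi>' c - 1)"
        define \<psi>1 where "\<psi>1 = \<psi>'(c := \<psi>' c - 1)"
        have eq: "\<phi>1(c := Suc (\<phi>1 c)) = \<phi>'" "\<psi>1(c := Suc (\<psi>1 c)) = \<psi>'"
          using c by (auto simp: \<phi>1_def \<psi>1_def)
        have at: "c \<in> atoms T" using f c fact_pos_atom by blast
        have fv: "\<beta> = (\<lambda>i. fval T \<phi>1 i + c i)" "\<beta> = (\<lambda>i. fval T \<psi>1 i + c i)"
          using fval_upd[OF at] eq f by metis+
        have "fval T \<phi>1 = fval T \<psi>1" using fv by (metis add_right_cancel ext)
        moreover have "deg I (fval T \<phi>1) < deg I \<beta>"
          using fv(1) atom_deg_pos[OF at] by (metis deg_add less_add_same_cancel1)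
        moreover have "is_fact T \<phi>1" "is_fact T \<psi>1"
          using f at is_fact_upd by (auto simp: \<phi>1_def \<psi>1_def)
        ultimately have "(step I T d)\<^sup>*\<^sup>* \<phi>1 \<psi>1" using less.hyps \<beta>_def by blast
        from steps_upd[OF this at] show ?thesis by (simp only: eq)
      qed
      have supp: "\<exists>a. \<chi> a > 0" if "fval T \<chi> = \<beta>" for \<chi>
      proof (rule ccontr)
        assume "\<not> ?thesis"
        then have "fval T \<chi> = (\<lambda>_. 0)" by (auto simp: fval_def)
        with that False show False by (auto simp: deg_def)
      qed
      obtain a b where ab: "\<phi> a > 0" "\<psi> b > 0" using supp \<beta>_def less.prems(3) by metis
      have at: "a \<in> atoms T" "b \<in> atoms T" using ab less.prems fact_pos_atom by blast+
      have \<beta>T: "\<beta> \<in> T"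
      proof -
        have "(\<lambda>i. \<Sum>a\<in>A. \<phi> a * a i) \<in> T" if "finite A" "A \<subseteq> atoms T" for A
          using that
        proof (induction A rule: finite_induct)
          case (insert x F)
          have "(\<lambda>i. k * x i) \<in> T" for k
            by (induction k) (use zero_mem add_mem insert.prems atoms_subset in auto)
          with insert add_mem show ?case by simp
        qed (use zero_mem in simp)
        from this[OF finite_atoms] show ?thesis by (simp add: \<beta>_def fval_def)
      qed
      have path: "(compatible T \<beta>)\<^sup>*\<^sup>* a b"
        using conn[OF \<beta>T] False at ab fact_dvd less.prems
        unfolding divisors_connected_def \<beta>_def by (metis not_le)
      \<comment> \<open>Claimed for every \<chi> containing c: the next edge of the path supplies a
        factorization \<omega> through both of its ends, to which the hypothesis is applied.\<close>
      have "\<forall>\<chi>. is_fact T \<chi> \<longrightarrow> fval T \<chi> = \<beta> \<longrightarrow> \<chi> c > 0 \<longrightarrow> (step I T d)\<^sup>*\<^sup>* \<phi> \<chi>"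
        if "(compatible T \<beta>)\<^sup>*\<^sup>* a c" for c
        using that
      proof (induction rule: rtranclp_induct)
        case base
        show ?case using share[OF \<phi> _ \<beta>_def[symmetric] _ ab(1)] by blast
      next
        case (step c' c)
        obtain \<omega> where \<omega>: "is_fact T \<omega>" "fval T \<omega> = \<beta>" "\<omega> c' > 0" "\<omega> c > 0"
          using fact_through_compatible[OF \<beta>T step.hyps(2)] by blast
        show ?case
        proof (intro allI impI)
          fix \<chi> assume \<chi>: "is_fact T \<chi>" "fval T \<chi> = \<beta>" "\<chi> c > 0"
          have "(step I T d)\<^sup>*\<^sup>* \<phi> \<omega>" using step.IH \<omega> by blast
          also have "(step I T d)\<^sup>*\<^sup>* \<omega> \<chi>" using share[OF \<omega>(1) \<chi>(1) \<omega>(2) \<chi>(2) \<omega>(4) \<chi>(3)] .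
          finally show "(step I T d)\<^sup>*\<^sup>* \<phi> \<chi>" .
        qed
      qed
      with path show ?thesis using less.prems ab \<beta>_def by metis
    qed
  qed
qed

text \<open>Neighbours in the chain must share an atom, since otherwise their distance would be deg
  \<beta> > d; the atoms of one factorization are pairwise compatible.\<close>

lemma connected_if_chainable:
  assumes ch: "chainable I T d" and \<beta>: "\<beta> \<in> T" "d < deg I \<beta>"
  shows "divisors_connected T \<beta>"
  unfolding divisors_connected_def
proof (intro ballI impI)
  fix a b assume ab: "a \<in> atoms T" "b \<in> atoms T" "a \<le> \<beta>" "b \<le> \<beta>"
  obtain \<phi> where \<phi>: "is_fact T \<phi>" "fval T \<phi> = \<beta>" "\<phi> a > 0" using fact_through \<beta> ab by metis
  obtain \<psi> where \<psi>: "is_fact T \<psi>" "fval T \<psi> = \<beta>" "\<psi> b > 0" using fact_through \<beta> ab by metis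
  obtain k f where f: "f 0 = \<phi>" "f k = \<psi>" "\<And>j. j \<le> k \<Longrightarrow> is_fact T (f j)"
    "\<And>j. j < k \<Longrightarrow> fval T (f j) = fval T (f (Suc j)) \<and> dgr I T (f j) (f (Suc j)) \<le> d"
    using ch \<phi> \<psi> unfolding chainable_def by metis
  have fv: "fval T (f j) = \<beta>" if "j \<le> k" for j
    using that by (induction j) (use f \<phi> in auto)
  have "\<forall>c. f j c > 0 \<longrightarrow> (compatible T \<beta>)\<^sup>*\<^sup>* a c" if "j \<le> k" for j
    using that
  proof (induction j)
    case 0
    then show ?case using f \<phi> fact_compatible_rtranclp by metis
  next
    case (Suc j)
    have "\<exists>e. f j e > 0 \<and> f (Suc j) e > 0"
    proof (rule ccontr)
      assume "\<not> ?thesis"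
      then have "(\<lambda>a. f j a - min (f j a) (f (Suc j) a)) = f j"
        by (auto simp: fun_eq_iff) (metis diff_zero min_0L min_0R)
      then have "gdeg I T (f j) \<le> d" using f(4)[of j] Suc.prems by (simp add: dgr_def)
      then show False using fv[of j] \<beta> Suc.prems by (simp add: gdeg_eq)
    qed
    then obtain e where e: "f j e > 0" "f (Suc j) e > 0" by blast
    show ?case
    proof (intro allI impI)
      fix c assume "f (Suc j) c > 0"
      then have "(compatible T \<beta>)\<^sup>*\<^sup>* e c"
        using fact_compatible_rtranclp[OF f(3)[OF Suc.prems] e(2)] fv[OF Suc.prems] by simp
      with Suc e show "(compatible T \<beta>)\<^sup>*\<^sup>* a c" by (meson Suc_leD rtranclp_trans)
    qed
  qed
  from this[of k] show "(compatible T \<beta>)\<^sup>*\<^sup>* a b" using f \<psi> by auto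
qed

text \<open>By saturation a splits in T as c + (a - c).\<close>

lemma atom_le_atom: "c \<in> atoms T \<Longrightarrow> a \<in> atoms T \<Longrightarrow> c \<le> a \<Longrightarrow> c = a"
proof -
  assume *: "c \<in> atoms T" "a \<in> atoms T" "c \<le> a"
  have "(\<lambda>i. a i - c i) \<in> T" "c \<in> T" using * diff_mem atoms_subset by blast+
  moreover have eq: "a = (\<lambda>i. c i + (a i - c i))" using *(3) by (auto simp: le_fun_def)
  ultimately have "c = (\<lambda>_. 0) \<or> (\<lambda>i. a i - c i) = (\<lambda>_. 0)" using *(2) unfolding atoms_def by blast
  with atom_nonzero[OF *(1)] have "(\<lambda>i. a i - c i) = (\<lambda>_. 0)" by blast
  then have "a i - c i = 0" for i by (rule fun_cong)
  with *(3) show "c = a" by (auto simp: le_fun_def intro!: antisym)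
qed

text \<open>Any two divisors of \<open>\<beta>\<close> are joined by a path whose consecutive joins have degree at most
  \<open>D + 1\<close>; the complement of such a join still has degree at least \<open>D\<close>, so it contains an
  atom compatible with both of its ends.\<close>

lemma connected_if_dominating:
  assumes dom: "\<And>\<alpha>. (\<And>i. i \<notin> I \<Longrightarrow> \<alpha> i = 0) \<Longrightarrow> D \<le> deg I \<alpha> \<Longrightarrow> \<exists>c\<in>atoms T. c \<le> \<alpha>"
    and \<beta>: "\<beta> \<in> T" "2 * D < deg I \<beta>"
  shows "divisors_connected T \<beta>"
  unfolding divisors_connected_def
proof (intro ballI impI)
  define L where "L = (\<lambda>a b. a \<in> atoms T \<and> b \<in> atoms T \<and> a \<le> \<beta> \<and> b \<le> \<beta> \<and>
    deg I (\<lambda>i. max (a i) (b i)) \<le> D + 1)"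
  \<comment> \<open>The ceiling \<gamma> varies so that the induction can lower it until its degree
    is at most D + 1.\<close>
  have path: "L\<^sup>*\<^sup>* a b" if "\<gamma> \<le> \<beta>" "a \<in> atoms T" "b \<in> atoms T" "a \<le> \<gamma>" "b \<le> \<gamma>" for \<gamma> a b
    using that
  proof (induction "deg I \<gamma>" arbitrary: \<gamma> a b rule: less_induct)
    case less
    have \<gamma>0: "\<gamma> i = 0" if "i \<notin> I" for i
      using that less.prems(1) vanish[OF \<beta>(1)] by (metis le_fun_def le_zero_eq)
    show ?case
    proof (cases "deg I \<gamma> \<le> D + 1")
      case True
      have "(\<lambda>i. max (a i) (b i)) \<le> \<gamma>" using less.prems by (auto simp: le_fun_def)
      from deg_mono[OF this, of I] True have "L a b"
        using less.prems by (auto simp: L_def)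
      then show ?thesis by blast
    next
      case False
      \<comment> \<open>If a were \<gamma> itself, then \<gamma> less one unit would still have
        degree at least D and dominate an atom strictly below the atom a.\<close>
      have small: "\<exists>x\<in>I. a x < \<gamma> x" if a: "a \<in> atoms T" "a \<le> \<gamma>" for a
      proof (rule ccontr)
        assume "\<not> ?thesis"
        then have "\<gamma> i \<le> a i" for i using \<gamma>0[of i] by (cases "i \<in> I") (auto simp: not_less)
        then have eq: "a = \<gamma>" using a(2) by (auto simp: le_fun_def intro!: antisym)
        have "deg I \<gamma> \<noteq> 0" using False by simp
        then have "\<exists>x\<in>I. \<gamma> x > 0" using finite_I by (auto simp: deg_def)
        then obtain x where x: "x \<in> I" "\<gamma> x > 0" by blast
        have lt: "\<gamma>(x := \<gamma> x - 1) \<le> \<gamma>" by (auto simp: le_fun_def)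
        have "deg I (\<gamma>(x := \<gamma> x - 1)) + 1 = deg I \<gamma>"
          using x finite_I by (simp add: deg_def sum.remove)
        then have "D \<le> deg I (\<gamma>(x := \<gamma> x - 1))" using False by simp
        moreover have "(\<gamma>(x := \<gamma> x - 1)) i = 0" if "i \<notin> I" for i using \<gamma>0[OF that] by auto
        ultimately obtain c where c: "c \<in> atoms T" "c \<le> \<gamma>(x := \<gamma> x - 1)"
          using dom by blast
        then have "c = a" using atom_le_atom a(1) lt eq by (metis order_trans)
        with c eq x show False by (auto simp: le_fun_def dest!: spec[of _ x])
      qed
      from small less.prems obtain x y where xy: "x \<in> I" "a x < \<gamma> x" "y \<in> I" "b y < \<gamma> y" by blast
      let ?e = "\<lambda>z i. if i = z then 1 else 0 :: nat"
      \<comment> \<open>One unit is removed at x and one at y, a single one if x = y. Degree at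
        least D remains, and the atom c found there lies below \<gamma> less the unit at x together
        with a, and below \<gamma> less the unit at y together with b.\<close>
      let ?m = "\<lambda>i. max (?e x i) (?e y i)"
      have "deg I ?m \<le> deg I (\<lambda>i. ?e x i + ?e y i)" by (rule deg_mono) (auto simp: le_fun_def)
      also have "\<dots> = 2" using xy finite_I by (simp add: deg_add) (simp add: deg_def)
      finally have "D \<le> deg I (\<lambda>i. \<gamma> i - ?m i)"
        using False deg_diff[of ?m \<gamma> I] xy by (auto simp: le_fun_def)
      then obtain c where c: "c \<in> atoms T" "c \<le> (\<lambda>i. \<gamma> i - ?m i)"
        using dom[of "\<lambda>i. \<gamma> i - ?m i"] \<gamma>0 by auto
      have dec: "deg I (\<lambda>i. \<gamma> i - ?e z i) < deg I \<gamma>" if "z \<in> I" "0 < \<gamma> z" for z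
        unfolding deg_def by (rule sum_strict_mono_ex1[OF finite_I]) (use that in auto)
      have down: "(\<lambda>i. \<gamma> i - ?e z i) \<le> \<beta>" for z
        using less.prems(1) by (auto simp: le_fun_def intro: order_trans[OF diff_le_self])
      have below: "c' \<le> (\<lambda>i. \<gamma> i - ?e z i)" if "c' \<le> \<gamma>" "c' z < \<gamma> z" for c' z
        using that by (auto simp: le_fun_def)
      have "(\<lambda>i. \<gamma> i - ?m i) \<le> \<gamma>" by (auto simp: le_fun_def)
      with c(2) have c': "c \<le> \<gamma>" by (rule order_trans)
      have c'': "c x < \<gamma> x" "c y < \<gamma> y"
        using le_funD[OF c(2), of x] le_funD[OF c(2), of y] xy by auto
      have "L\<^sup>*\<^sup>* a c"
        by (rule less.hyps[OF dec[of x] down]) (use xy below less.prems c(1) c' c'' in auto)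
      moreover have "L\<^sup>*\<^sup>* c b"
        by (rule less.hyps[OF dec[of y] down]) (use xy below less.prems c(1) c' c'' in auto)
      ultimately show ?thesis by simp
    qed
  qed
  have edge: "(compatible T \<beta>)\<^sup>*\<^sup>* a b" if "L a b" for a b
  proof -
    let ?s = "\<lambda>i. max (a i) (b i)"
    have ab: "a \<in> atoms T" "b \<in> atoms T" using that by (auto simp: L_def)
    have le: "?s \<le> \<beta>" using that by (auto simp: L_def le_fun_def)
    have "D \<le> deg I (\<lambda>i. \<beta> i - ?s i)" using deg_diff[OF le] that \<beta>(2) by (auto simp: L_def)
    then obtain c where c: "c \<in> atoms T" "c \<le> (\<lambda>i. \<beta> i - ?s i)"
      using dom[of "\<lambda>i. \<beta> i - ?s i"] vanish[OF \<beta>(1)] by auto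
    have *: "c i + max (a i) (b i) \<le> \<beta> i" for i
      using le_funD[OF c(2), of i] le_funD[OF le, of i] by linarith
    have "a i + c i \<le> \<beta> i \<and> c i + b i \<le> \<beta> i" for i using *[of i] by linarith
    then have "compatible T \<beta> a c" "compatible T \<beta> c b" using ab c(1) by (auto simp: compatible_def)
    then show ?thesis by (meson r_into_rtranclp rtranclp.rtrancl_into_rtrancl)
  qed
  fix a b assume ab: "a \<in> atoms T" "b \<in> atoms T" "a \<le> \<beta>" "b \<le> \<beta>"
  have "L\<^sup>*\<^sup>* a b" by (rule path[OF order_refl ab])
  then show "(compatible T \<beta>)\<^sup>*\<^sup>* a b"
    by (induction rule: rtranclp_induct) (auto dest: edge)
qed

end

section \<open>Walking on the vertices of a polyhedron\<close>

text \<open>The polyhedron of a linear program in standard form with columns \<open>v k\<close>.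
  Points vanish off A so that equality of points is equality of functions.\<close>

definition feasible :: "'k set \<Rightarrow> ('k \<Rightarrow> 'i \<Rightarrow> real) \<Rightarrow> ('i \<Rightarrow> real) \<Rightarrow> ('k \<Rightarrow> real) \<Rightarrow> bool" where
  "feasible A v \<beta> q \<longleftrightarrow> (\<forall>k. 0 \<le> q k) \<and> (\<forall>k. k \<notin> A \<longrightarrow> q k = 0) \<and> (\<forall>i. (\<Sum>k\<in>A. q k * v k i) = \<beta> i)"

definition in_kernel :: "'k set \<Rightarrow> ('k \<Rightarrow> 'i \<Rightarrow> real) \<Rightarrow> ('k \<Rightarrow> real) \<Rightarrow> bool" where
  "in_kernel A v d \<longleftrightarrow> (\<forall>k. k \<notin> A \<longrightarrow> d k = 0) \<and> (\<forall>i. (\<Sum>k\<in>A. d k * v k i) = 0)"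

text \<open>Linear independence of the columns with index in J and A; a feasible point with
  independent support is a vertex (basic solution).\<close>

definition indep :: "'k set \<Rightarrow> ('k \<Rightarrow> 'i \<Rightarrow> real) \<Rightarrow> 'k set \<Rightarrow> bool" where
  "indep A v J \<longleftrightarrow> (\<forall>d. in_kernel A v d \<longrightarrow> (\<forall>k. k \<notin> J \<longrightarrow> d k = 0) \<longrightarrow> (\<forall>k. d k = 0))"

lemma indepD: "indep A v J \<Longrightarrow> in_kernel A v d \<Longrightarrow> (\<And>k. k \<notin> J \<Longrightarrow> d k = 0) \<Longrightarrow> d k = 0"
  unfolding indep_def by blast

lemma indep_mono: "indep A v J \<Longrightarrow> J' \<subseteq> J \<Longrightarrow> indep A v J'"
  unfolding indep_def by blast

lemma kernel_lincomb:
  "in_kernel A v d \<Longrightarrow> in_kernel A v e \<Longrightarrow> in_kernel A v (\<lambda>k. x * d k + y * e k)"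
  by (simp add: in_kernel_def distrib_right sum.distrib mult.assoc flip: sum_distrib_left)

lemma kernel_uminus: "in_kernel A v d \<Longrightarrow> in_kernel A v (\<lambda>k. - d k)"
  using kernel_lincomb[of A v d d "-1" 0] by simp

lemma kernel_diff: "feasible A v \<beta> q \<Longrightarrow> feasible A v \<beta> q' \<Longrightarrow> in_kernel A v (\<lambda>k. q k - q' k)"
  by (simp add: in_kernel_def feasible_def left_diff_distrib sum_subtractf)

lemma feasible_add:
  assumes "feasible A v \<beta> q" "in_kernel A v d" "\<And>k. k \<in> A \<Longrightarrow> 0 \<le> q k + t * d k"
  shows "feasible A v \<beta> (\<lambda>k. q k + t * d k)"
proof -
  have "0 \<le> q k + t * d k" for k
    using assms by (cases "k \<in> A") (auto simp: feasible_def in_kernel_def)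
  with assms show ?thesis
    by (simp add: in_kernel_def feasible_def distrib_right sum.distrib mult.assoc flip: sum_distrib_left)
qed

text \<open>The minimum ratio rule of the simplex method: t is the least \<open>q k / - d k\<close>
  over decreasing coordinates, positive because q is positive on those.\<close>

lemma ratio_test:
  fixes q d :: "'k \<Rightarrow> real"
  assumes "finite A" "\<And>k. k \<in> A \<Longrightarrow> 0 \<le> q k" "\<And>k. k \<in> A \<Longrightarrow> d k < 0 \<Longrightarrow> 0 < q k"
    and "\<exists>k\<in>A. d k < 0"
  obtains t k where "t > 0" "k \<in> A" "d k < 0" "q k + t * d k = 0" "\<forall>k\<in>A. 0 \<le> q k + t * d k"
proof -
  define N where "N = {k\<in>A. d k < 0}"
  have N: "finite N" "N \<noteq> {}" using assms by (auto simp: N_def)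
  define t where "t = Min ((\<lambda>k. q k / - d k) ` N)"
  have "t \<in> (\<lambda>k. q k / - d k) ` N" unfolding t_def using N by (intro Min_in) auto
  then obtain k where k: "k \<in> N" "t = q k / - d k" by blast
  have min: "t \<le> q j / - d j" if "j \<in> N" for j unfolding t_def using N that by auto
  show thesis
  proof
    show "k \<in> A" "d k < 0" using k by (auto simp: N_def)
    then show t: "t > 0" unfolding k(2) using assms(3) by (intro divide_pos_pos) auto
    show "q k + t * d k = 0" using k by (auto simp: N_def)
    have "0 \<le> q j + t * d j" if "j \<in> A" for j
    proof (cases "d j < 0")
      case True
      with min[of j] that show ?thesis by (auto simp: N_def field_simps)
    next
      case False
      then show ?thesis using t assms(2)[OF that] by simp
    qed
    then show "\<forall>k\<in>A. 0 \<le> q k + t * d k" ..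
  qed
qed

text \<open>As long as the support is dependent, a kernel vector on it allows moving until a
  coordinate vanishes, which shrinks the support.\<close>

lemma vertex_exists:
  assumes "finite A" "feasible A v \<beta> q"
  shows "\<exists>q'. feasible A v \<beta> q' \<and> {k. q' k \<noteq> 0} \<subseteq> {k. q k \<noteq> 0} \<and> indep A v {k. q' k \<noteq> 0}"
  using assms(2)
proof (induction "card {k. q k \<noteq> 0}" arbitrary: q rule: less_induct)
  case less
  have fin: "finite {k. q k \<noteq> 0}"
    using less.prems assms(1) by (auto simp: feasible_def intro: finite_subset[of _ A])
  show ?case
  proof (cases "indep A v {k. q k \<noteq> 0}")
    case False
    then obtain d0 j where d0: "in_kernel A v d0" "\<And>k. q k = 0 \<Longrightarrow> d0 k = 0" "d0 j \<noteq> 0"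
      by (auto simp: indep_def)
    obtain d where d: "in_kernel A v d" "\<And>k. q k = 0 \<Longrightarrow> d k = 0" "d j < 0"
    proof (cases "d0 j < 0")
      case False
      then show thesis using that[of "\<lambda>k. - d0 k"] d0 kernel_uminus by auto
    qed (use that d0 in blast)
    have "j \<in> A" using d by (auto simp: in_kernel_def)
    then have ex: "\<exists>k\<in>A. d k < 0" using d(3) by blast
    have qpos: "0 < q k" if "d k < 0" for k
    proof -
      have "q k \<noteq> 0" using that d(2)[of k] by auto
      moreover have "0 \<le> q k" using less.prems by (simp add: feasible_def)
      ultimately show ?thesis by simp
    qed
    have q0: "0 \<le> q k" for k using less.prems by (simp add: feasible_def)
    obtain t k where tk: "t > 0" "k \<in> A" "d k < 0" "q k + t * d k = 0"
      "\<forall>k\<in>A. 0 \<le> q k + t * d k"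
      by (rule ratio_test[OF assms(1) q0 qpos ex])
    let ?q = "\<lambda>k. q k + t * d k"
    have sub: "{k. ?q k \<noteq> 0} \<subset> {k. q k \<noteq> 0}"     proof (rule psubsetI)
      show "{k. ?q k \<noteq> 0} \<subseteq> {k. q k \<noteq> 0}" using d(2) by auto
      show "{k. ?q k \<noteq> 0} \<noteq> {k. q k \<noteq> 0}" using qpos[OF tk(3)] tk(4) by fastforce
    qed
    from less.hyps[OF psubset_card_mono[OF fin sub] feasible_add[OF less.prems d(1) tk(5)[rule_format]]]
    obtain q' where "feasible A v \<beta> q'" "{k. q' k \<noteq> 0} \<subseteq> {k. ?q k \<noteq> 0}" "indep A v {k. q' k \<noteq> 0}"
      by blast
    with sub show ?thesis by (intro exI[of _ q']) auto
  qed (use less.prems in blast)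
qed

text \<open>An extreme ray of the tangent cone at a vertex with support \<open>J\<close>; minimality of the support
  outside \<open>J\<close> makes the direction unique up to scaling.\<close>

lemma edge_direction:
  fixes c :: "'k \<Rightarrow> real"
  assumes "finite A" "indep A v J"
    and "in_kernel A v d" "\<And>k. k \<notin> J \<Longrightarrow> 0 \<le> d k" "(\<Sum>k\<in>A. c k * d k) < 0"
  shows "\<exists>d. in_kernel A v d \<and> (\<forall>k. k \<notin> J \<longrightarrow> 0 \<le> d k) \<and> (\<Sum>k\<in>A. c k * d k) < 0 \<and>
     (\<forall>e. in_kernel A v e \<longrightarrow> (\<forall>k. k \<notin> J \<longrightarrow> d k = 0 \<longrightarrow> e k = 0) \<longrightarrow> (\<exists>s. \<forall>k. e k = s * d k))"
  using assms(3-5)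
proof (induction "card ({k. d k \<noteq> 0} - J)" arbitrary: d rule: less_induct)
  case less
  have fin: "finite ({k. d k \<noteq> 0} - J)"
    using less.prems(1) assms(1) by (auto simp: in_kernel_def intro: finite_subset[of _ A])
  show ?case
  proof (cases "\<forall>e. in_kernel A v e \<longrightarrow> (\<forall>k. k \<notin> J \<longrightarrow> d k = 0 \<longrightarrow> e k = 0) \<longrightarrow> (\<exists>s. \<forall>k. e k = s * d k)")
    case True
    then show ?thesis using less.prems by blast
  next
    case False
    then obtain e where e: "in_kernel A v e" "\<And>k. k \<notin> J \<Longrightarrow> d k = 0 \<Longrightarrow> e k = 0"
      "\<And>s. \<exists>k. e k \<noteq> s * d k" by blast
    let ?l = "\<lambda>d. \<Sum>k\<in>A. c k * d k"
    \<comment> \<open>The combination of d and e on which the objective vanishes; it is nonzero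
      because e is not a multiple of d.\<close>
    define e1 where "e1 = (\<lambda>k. ?l d * e k + (- ?l e) * d k)"
    have e1: "in_kernel A v e1" unfolding e1_def by (rule kernel_lincomb) (use e less.prems in auto)
    have le1: "?l e1 = 0"
    proof -
      have "?l e1 = (\<Sum>k\<in>A. ?l d * (c k * e k) - ?l e * (c k * d k))"
        by (intro sum.cong refl) (simp add: e1_def algebra_simps)
      also have "\<dots> = ?l d * ?l e - ?l e * ?l d" by (simp only: sum_subtractf sum_distrib_left)
      finally show ?thesis by simp
    qed
    obtain k0 where "e k0 \<noteq> (?l e / ?l d) * d k0" using e(3) by blast
    have e1z: "e1 k = 0" if "k \<notin> J" "d k = 0" for k using e(2)[OF that] that by (simp add: e1_def)
    from \<open>e k0 \<noteq> _\<close> have "e1 k0 \<noteq> 0" using less.prems(3) by (auto simp: e1_def field_simps)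
    \<comment> \<open>A nonzero kernel vector cannot live on the independent set J. Up to sign it
      decreases at such a j, and following it from d kills a coordinate outside J.\<close>
    then obtain j where j: "j \<notin> J" "e1 j \<noteq> 0" using indepD[OF assms(2) e1] by blast
    obtain e2 where e2: "in_kernel A v e2" "?l e2 = 0" "e2 j < 0" "\<And>k. k \<notin> J \<Longrightarrow> d k = 0 \<Longrightarrow> e2 k = 0"
    proof (cases "e1 j < 0")
      case True
      then show thesis using that[of e1] e1 le1 e1z by blast
    next
      case False
      then show thesis using that[of "\<lambda>k. - e1 k"] kernel_uminus[OF e1] le1 j e1z
        by (simp add: sum_negf)
    qed
    have "j \<in> A - J" using e2 j by (auto simp: in_kernel_def)
    then have ex: "\<exists>k\<in>A - J. e2 k < 0" using e2(3) by blast
    have dpos: "0 < d k" if "k \<in> A - J" "e2 k < 0" for k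
      using that e2(4)[of k] less.prems(2)[of k] by (cases "d k = 0") auto
    have d0: "0 \<le> d k" if "k \<in> A - J" for k using that less.prems(2) by blast
    obtain t k where tk: "t > 0" "k \<in> A - J" "e2 k < 0" "d k + t * e2 k = 0"
      "\<forall>k\<in>A - J. 0 \<le> d k + t * e2 k"
      by (rule ratio_test[OF finite_Diff[OF assms(1)] d0 dpos ex])
    let ?d = "\<lambda>k. d k + t * e2 k"
    have "{k. ?d k \<noteq> 0} - J \<subset> {k. d k \<noteq> 0} - J" using tk e2 by auto
    then have "card ({k. ?d k \<noteq> 0} - J) < card ({k. d k \<noteq> 0} - J)"
      using fin psubset_card_mono by blast
    moreover have "in_kernel A v ?d" using kernel_lincomb[OF less.prems(1) e2(1), of 1 t] by simp
    moreover have "0 \<le> ?d k" if "k \<notin> J" for k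
      using that tk(5) less.prems(1) e2(1) by (cases "k \<in> A") (auto simp: in_kernel_def)
    \<comment> \<open>The objective is unchanged, being zero on \<open>e2\<close>.\<close>
    moreover have "?l ?d < 0"
    proof -
      have "?l ?d = ?l d + t * ?l e2"
        by (simp add: sum.distrib sum_distrib_left algebra_simps)
      with e2 less.prems(3) show ?thesis by simp
    qed
    ultimately show ?thesis by (rule less.hyps[of ?d])
  qed
qed

text \<open>The direction w - q improves the objective and is replaced by an extreme improving ray
  d. The edge lives on F, the union of the supports of q and d, where every kernel vector is a
  multiple of d; deleting an index with d nonzero therefore makes F independent.\<close>

lemma simplex_pivot:
  fixes A :: "'k set" and c :: "'k \<Rightarrow> real"
  defines "l \<equiv> \<lambda>q. \<Sum>k\<in>A. c k * q k"
  assumes "finite A" and q: "feasible A v \<beta> q" "indep A v {k. q k \<noteq> 0}"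
    and w: "feasible A v \<beta> w" "l w < l q" and c: "\<And>k. 0 \<le> c k"
  obtains t d F f where "t > 0" "\<forall>s. 0 \<le> s \<longrightarrow> s \<le> t \<longrightarrow> feasible A v \<beta> (\<lambda>k. q k + s * d k)"
    "\<forall>k s. k \<notin> F \<longrightarrow> q k + s * d k = 0" "F \<subseteq> A" "indep A v (F - {f})"
    "indep A v {k. q k + t * d k \<noteq> 0}" "l (\<lambda>k. q k + t * d k) < l q"
proof -
  let ?J = "{k. q k \<noteq> 0}"
  have "l (\<lambda>k. w k - q k) < 0" using w by (simp add: l_def right_diff_distrib sum_subtractf)
  moreover have "0 \<le> w k - q k" if "k \<notin> ?J" for k using that w by (auto simp: feasible_def)
  ultimately obtain d where d: "in_kernel A v d" "\<And>k. k \<notin> ?J \<Longrightarrow> 0 \<le> d k" "l d < 0"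
    "\<And>e. in_kernel A v e \<Longrightarrow> (\<And>k. k \<notin> ?J \<Longrightarrow> d k = 0 \<Longrightarrow> e k = 0) \<Longrightarrow> \<exists>s. \<forall>k. e k = s * d k"
    using edge_direction[OF assms(2) q(2) kernel_diff[OF w(1) q(1)], of c] unfolding l_def by blast
  define F where "F = ?J \<union> {k. d k \<noteq> 0}"
  have indF: "indep A v (F - {f})" if "d f \<noteq> 0" for f
    unfolding indep_def
  proof (intro allI impI)
    fix e k assume e: "in_kernel A v e" "\<forall>k. k \<notin> F - {f} \<longrightarrow> e k = 0"
    then obtain s where s: "\<And>k. e k = s * d k" using d(4)[of e] by (auto simp: F_def)
    have "e f = 0" using e by auto
    with s that show "e k = 0" by auto
  qed
  \<comment> \<open>The costs c are nonnegative, so an improving ray must decrease some coordinate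
    and the edge is bounded.\<close>
  have ex: "\<exists>k\<in>A. d k < 0"
  proof (rule ccontr)
    assume "\<not> ?thesis"
    then have "0 \<le> l d" unfolding l_def using c by (intro sum_nonneg mult_nonneg_nonneg) auto
    with d show False by simp
  qed
  have q0: "0 \<le> q k" for k using q(1) by (simp add: feasible_def)
  have qpos: "0 < q k" if "d k < 0" for k
  proof -
    have "q k \<noteq> 0" using d(2)[of k] that by auto
    moreover have "0 \<le> q k" using q(1) by (simp add: feasible_def)
    ultimately show ?thesis by simp
  qed
  obtain t k where tk: "t > 0" "k \<in> A" "d k < 0" "q k + t * d k = 0"
      "\<forall>k\<in>A. 0 \<le> q k + t * d k"
    by (rule ratio_test[OF assms(2) q0 qpos ex])
  show thesis
  proof
    show "t > 0" by fact
    show "\<forall>s. 0 \<le> s \<longrightarrow> s \<le> t \<longrightarrow> feasible A v \<beta> (\<lambda>k. q k + s * d k)"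
    proof (intro allI impI feasible_add[OF q(1) d(1)])
      fix s k assume s: "0 \<le> s" "s \<le> t" and k: "k \<in> A"
      show "0 \<le> q k + s * d k"
      proof (cases "d k < 0")
        case True
        then have "t * d k \<le> s * d k" using s by (intro mult_right_mono_neg) auto
        with tk(5) k show ?thesis by fastforce
      qed (use s q(1) in \<open>auto simp: feasible_def\<close>)
    qed
    show "\<forall>k s. k \<notin> F \<longrightarrow> q k + s * d k = 0" by (auto simp: F_def)
    show "F \<subseteq> A" using q(1) d(1) by (auto simp: F_def feasible_def in_kernel_def)
    show "indep A v (F - {k})" using indF tk by auto
    show "indep A v {k. q k + t * d k \<noteq> 0}"
      by (rule indep_mono[OF indF[of k]]) (use tk in \<open>auto simp: F_def\<close>)
    have "l (\<lambda>k. q k + t * d k) = l q + t * l d"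
      by (simp add: l_def sum.distrib sum_distrib_left algebra_simps)
    then show "l (\<lambda>k. q k + t * d k) < l q" using d(3) tk(1) by (simp add: mult_pos_neg)
  qed
qed

text \<open>Along each edge the sets where some coordinate inside, respectively outside, \<open>C\<close> is at
  least 1 are closed, disjoint and cover the edge, so the simplex walk minimising the mass outside
  \<open>C\<close> can never enter \<open>C\<close>.\<close>

lemma polyhedron_inseparable:
  assumes fin: "finite A"
    and large: "\<And>q F f. feasible A v \<beta> q \<Longrightarrow> (\<And>k. k \<notin> F \<Longrightarrow> q k = 0) \<Longrightarrow> F \<subseteq> A \<Longrightarrow>
           indep A v (F - {f}) \<Longrightarrow> \<exists>k. 1 \<le> q k"
    and clique: "\<And>q j k. feasible A v \<beta> q \<Longrightarrow> 1 \<le> q j \<Longrightarrow> 1 \<le> q k \<Longrightarrow> j \<in> C \<Longrightarrow> k \<in> C"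
    and z: "feasible A v \<beta> z" "\<And>k. k \<in> C \<Longrightarrow> z k = 0"
    and w: "feasible A v \<beta> w" "\<And>k. k \<notin> C \<Longrightarrow> w k = 0"
  shows False
proof -
  \<comment> \<open>The vertices with no large coordinate in C; the walk is replaced by a minimiser
    of l over this finite set.\<close>
  define V where "V = {q. feasible A v \<beta> q \<and> indep A v {k. q k \<noteq> 0} \<and> (\<forall>k\<in>C. q k < 1)}"
  define c where "c = (\<lambda>k. if k \<in> C then 0 else 1 :: real)"
  define l where "l = (\<lambda>q. \<Sum>k\<in>A. c k * q k)"
  \<comment> \<open>Points with the same independent support differ by a kernel vector on it, hence
    coincide; V embeds into the subsets of A.\<close>
  have "inj_on (\<lambda>q. {k. q k \<noteq> 0}) V"
  proof (rule inj_onI)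
    fix q q' assume *: "q \<in> V" "q' \<in> V" "{k. q k \<noteq> 0} = {k. q' k \<noteq> 0}"
    have "q k - q' k = 0" for k
      by (rule indepD[OF _ kernel_diff, of A v "{k. q k \<noteq> 0}" \<beta>]) (use * in \<open>auto simp: V_def\<close>)
    then show "q = q'" by auto
  qed
  moreover have "(\<lambda>q. {k. q k \<noteq> 0}) ` V \<subseteq> Pow A" by (auto simp: V_def feasible_def)
  ultimately have finV: "finite V" using fin by (meson finite_Pow_iff inj_on_finite)
  obtain z' where z': "feasible A v \<beta> z'" "{k. z' k \<noteq> 0} \<subseteq> {k. z k \<noteq> 0}" "indep A v {k. z' k \<noteq> 0}"
    using vertex_exists[OF fin z(1)] by blast
  have "\<forall>k\<in>C. z' k < 1"
  proof
    fix k assume "k \<in> C"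
    then have "z' k = 0" using z(2) z'(2) by blast
    then show "z' k < 1" by simp
  qed
  then have "z' \<in> V" using z' by (auto simp: V_def)
  then obtain q where qV: "q \<in> V" and qmin: "\<And>q'. q' \<in> V \<Longrightarrow> l q \<le> l q'"
    using ex_min_if_finite[of "l ` V"] finV
    by (metis (no_types, lifting) empty_iff finite_imageI image_iff linorder_not_less)
  have q: "feasible A v \<beta> q" "indep A v {k. q k \<noteq> 0}" "\<And>k. k \<in> C \<Longrightarrow> q k < 1"
    using qV by (auto simp: V_def)
  \<comment> \<open>The support of a vertex is independent already, so any index, here
    \<open>undefined\<close>, may be deleted.\<close>
  have "\<exists>k. 1 \<le> q k"
    by (rule large[OF q(1), of "{k. q k \<noteq> 0}" undefined])
      (use q(1) in \<open>auto intro: indep_mono[OF q(2)] simp: feasible_def\<close>)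
  then obtain k0 where k0: "1 \<le> q k0" by blast
  then have k0A: "k0 \<in> A - C" using q by (force simp: feasible_def)
  \<comment> \<open>The large coordinate \<open>k0\<close> lies outside C and costs at least 1,
    while w costs nothing; hence a pivot is possible.\<close>
  have "0 < l q" unfolding l_def
    by (rule sum_pos2[OF fin, of k0]) (use k0 k0A q(1) in \<open>auto simp: c_def feasible_def\<close>)
  moreover have "l w = 0" unfolding l_def using w by (intro sum.neutral) (auto simp: c_def)
  ultimately have lt: "(\<Sum>k\<in>A. c k * w k) < (\<Sum>k\<in>A. c k * q k)" by (simp add: l_def)
  have cpos: "0 \<le> c k" for k by (simp add: c_def)
  obtain t d F f where
    t: "t > 0" and feas': "\<forall>s. 0 \<le> s \<longrightarrow> s \<le> t \<longrightarrow> feasible A v \<beta> (\<lambda>k. q k + s * d k)"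
    and F: "\<forall>k s. k \<notin> F \<longrightarrow> q k + s * d k = 0" "F \<subseteq> A" "indep A v (F - {f})"
    and new: "indep A v {k. q k + t * d k \<noteq> 0}" "l (\<lambda>k. q k + t * d k) < l q"
    unfolding l_def by (rule simplex_pivot[OF fin q(1,2) w(1) lt cpos])
  have feas: "feasible A v \<beta> (\<lambda>k. q k + s * d k)" if "0 \<le> s" "s \<le> t" for s
    using feas' that by blast
  \<comment> \<open>By minimality of q the far end of the edge has a large coordinate in C, whereas
    q has one outside C.\<close>
  have "(\<lambda>k. q k + t * d k) \<notin> V" using qmin new(2) by force
  then obtain k1 where k1: "k1 \<in> C" "1 \<le> q k1 + t * d k1"
    using feas[of t] t new(1) by (force simp: V_def)
  have k1A: "k1 \<in> A" using k1(2) F(1,2) by force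
  let ?U = "\<lambda>B. \<Union>k\<in>B. {s. 1 \<le> q k + s * d k}"
  have "closed {s. 1 \<le> q k + s * d k}" for k
    by (intro closed_Collect_le continuous_intros)
  then have closed: "closed (?U B)" if "B \<subseteq> A" for B
    using finite_subset[OF that fin] by (intro closed_UN) auto
  have cover: "{0..t} \<subseteq> ?U (A \<inter> C) \<union> ?U (A - C)"
  proof
    fix s assume s: "s \<in> {0..t}"
    have "\<exists>k. 1 \<le> q k + s * d k"
      by (rule large[OF feas]) (use s F in auto)
    then obtain k where k: "1 \<le> q k + s * d k" by blast
    then have "k \<in> A" using F(1,2) by force
    with k show "s \<in> ?U (A \<inter> C) \<union> ?U (A - C)" by auto
  qed
  have disj: "?U (A \<inter> C) \<inter> ?U (A - C) \<inter> {0..t} = {}"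
  proof (rule ccontr)
    assume "\<not> ?thesis"
    then obtain s j k where s: "0 \<le> s" "s \<le> t" "1 \<le> q j + s * d j" "1 \<le> q k + s * d k" "j \<in> C" "k \<notin> C"
      by auto
    then show False using clique[OF feas[OF s(1,2)]] by blast
  qed
  have "?U (A \<inter> C) \<inter> {0..t} = {} \<or> ?U (A - C) \<inter> {0..t} = {}"
    by (rule connected_closedD[OF connected_Icc disj cover]) (use closed in auto)
  moreover have "0 \<in> ?U (A - C) \<inter> {0..t}" using k0 k0A t by auto
  moreover have "t \<in> ?U (A \<inter> C) \<inter> {0..t}" using k1 k1A t by auto
  ultimately show False by blast
qed

section \<open>Rank and the bound for saturated monoids\<close>

text \<open>Fraction-free Gaussian elimination, one equation at a time with a pivot
  \<open>k0\<close>.\<close>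

lemma int_relation:
  fixes f :: "'k \<Rightarrow> 'i \<Rightarrow> int"
  assumes "finite I" "finite K" "card I < card K"
  shows "\<exists>c. (\<exists>k\<in>K. c k \<noteq> 0) \<and> (\<forall>i\<in>I. (\<Sum>k\<in>K. c k * f k i) = 0)"
  using assms
proof (induction I arbitrary: f K rule: finite_induct)
  case empty
  then obtain k where "k \<in> K" by fastforce
  then show ?case by (intro exI[of _ "\<lambda>_. 1"]) auto
next
  case (insert x I)
  show ?case
  proof (cases "\<forall>k\<in>K. f k x = 0")
    case True
    with insert.IH[OF insert.prems(1), of f] insert.prems insert.hyps show ?thesis by auto
  next
    case False
    then obtain k0 where k0: "k0 \<in> K" "f k0 x \<noteq> 0" by blast
    have "card I < card (K - {k0})" using insert k0 by simp
    then obtain c where c: "\<exists>k\<in>K - {k0}. c k \<noteq> 0"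
      "\<And>i. i \<in> I \<Longrightarrow> (\<Sum>k\<in>K - {k0}. c k * (f k0 x * f k i - f k x * f k0 i)) = 0"
      using insert.IH[of "K - {k0}" "\<lambda>k i. f k0 x * f k i - f k x * f k0 i"] insert.prems by blast
    \<comment> \<open>The coefficient at \<open>k0\<close> is chosen to satisfy equation x; scaling
      the others by \<open>f k0 x\<close> avoids division.\<close>
    define e where "e = (\<lambda>k. if k = k0 then - (\<Sum>k\<in>K - {k0}. c k * f k x) else f k0 x * c k)"
    have sum: "(\<Sum>k\<in>K. e k * f k i) = (\<Sum>k\<in>K - {k0}. c k * (f k0 x * f k i - f k x * f k0 i))" for i
    proof -
      have "(\<Sum>k\<in>K. e k * f k i) = e k0 * f k0 i + (\<Sum>k\<in>K - {k0}. e k * f k i)"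
        using insert.prems k0 by (simp add: sum.remove)
      also have "(\<Sum>k\<in>K - {k0}. e k * f k i) = (\<Sum>k\<in>K - {k0}. f k0 x * c k * f k i)"
        by (intro sum.cong) (auto simp: e_def)
      finally show ?thesis
        by (simp add: e_def right_diff_distrib sum_subtractf sum_distrib_left sum_distrib_right mult_ac)
    qed
    have "(\<Sum>k\<in>K. e k * f k i) = 0" if "i \<in> insert x I" for i
      using that c(2) unfolding sum by (auto simp: mult.commute)
    moreover have "\<exists>k\<in>K. e k \<noteq> 0" using c(1) k0 by (auto simp: e_def)
    ultimately show ?thesis by blast
  qed
qed

section \<open>Integral rank and independence of the atoms\<close>

abbreviation coords :: "('i \<Rightarrow> nat) \<Rightarrow> 'i \<Rightarrow> real" where
  "coords a i \<equiv> real (a i)"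

context saturated_monoid
begin

lemma zspan_atoms:
  assumes "v \<in> zspan T"
  shows "\<exists>M. v = (\<lambda>i. \<Sum>a\<in>atoms T. M a * int (a i))"
proof -
  obtain F c where F: "F \<subseteq> T" "v = (\<lambda>i. \<Sum>t\<in>F. c t * int (t i))"
    using assms by (auto simp: zspan_def)
  obtain \<phi> where \<phi>: "\<And>t. t \<in> T \<Longrightarrow> fval T (\<phi> t) = t" using fact_exists by metis
  have "v i = (\<Sum>a\<in>atoms T. (\<Sum>t\<in>F. c t * int (\<phi> t a)) * int (a i))" for i
  proof -
    have "v i = (\<Sum>t\<in>F. c t * int (fval T (\<phi> t) i))"
      unfolding F(2) by (intro sum.cong refl) (use \<phi> F(1) in auto)
    also have "\<dots> = (\<Sum>t\<in>F. \<Sum>a\<in>atoms T. c t * int (\<phi> t a) * int (a i))"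
      by (simp add: fval_def sum_distrib_left mult.assoc)
    also have "\<dots> = (\<Sum>a\<in>atoms T. \<Sum>t\<in>F. c t * int (\<phi> t a) * int (a i))" by (rule sum.swap)
    finally show ?thesis by (simp add: sum_distrib_right)
  qed
  then show ?thesis by (intro exI ext)
qed

lemma z_indep_card_le:
  assumes "finite S" "S \<subseteq> zspan T" "z_indep S"
  shows "card S \<le> card (atoms T)"
proof (rule ccontr)
  assume neg: "\<not> ?thesis"
  have "\<forall>s\<in>S. \<exists>M. s = (\<lambda>i. \<Sum>a\<in>atoms T. M a * int (a i))"
    using zspan_atoms assms(2) by blast
  from bchoice[OF this] obtain M
    where M: "\<And>s. s \<in> S \<Longrightarrow> s = (\<lambda>i. \<Sum>a\<in>atoms T. M s a * int (a i))" by blast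
  obtain c where c: "\<exists>s\<in>S. c s \<noteq> 0" "\<forall>a\<in>atoms T. (\<Sum>s\<in>S. c s * M s a) = 0"
    using int_relation[OF finite_atoms assms(1), of M] neg by auto
  have "(\<Sum>s\<in>S. c s * s i) = 0" for i
  proof -
    have "(\<Sum>s\<in>S. c s * s i) = (\<Sum>s\<in>S. \<Sum>a\<in>atoms T. c s * M s a * int (a i))"
      by (intro sum.cong refl, subst M) (auto simp: sum_distrib_left mult.assoc)
    also have "\<dots> = (\<Sum>a\<in>atoms T. \<Sum>s\<in>S. c s * M s a * int (a i))" by (rule sum.swap)
    also have "\<dots> = 0" by (intro sum.neutral) (simp add: c(2) flip: sum_distrib_right)
    finally show ?thesis .
  qed
  with assms(3) c(1) show False unfolding z_indep_def by blast
qed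

text \<open>The relation c0 joins the coefficient rows of S as one more row. It evaluates to zero on
  the atoms, so a dependency of all rows evaluates to a relation within S; independence of S then
  forces c0 = 0. Hence card S + 1 rows fit into card (atoms T) columns.\<close>

lemma z_indep_card_less:
  assumes "finite S" "S \<subseteq> zspan T" "z_indep S"
    and rel: "\<exists>a\<in>atoms T. c0 a \<noteq> 0" "\<And>i. (\<Sum>a\<in>atoms T. c0 a * int (a i)) = 0"
  shows "card S < card (atoms T)"
proof (rule ccontr)
  assume neg: "\<not> ?thesis"
  have "\<forall>s\<in>S. \<exists>M. s = (\<lambda>i. \<Sum>a\<in>atoms T. M a * int (a i))"
    using zspan_atoms assms(2) by blast
  from bchoice[OF this] obtain M
    where M: "\<And>s. s \<in> S \<Longrightarrow> s = (\<lambda>i. \<Sum>a\<in>atoms T. M s a * int (a i))" by blast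
  let ?K = "insert None (Some ` S)"
  have "finite ?K" "card (atoms T) < card ?K"
    using neg assms(1) by (auto simp: card_image)
  then obtain e where e: "\<exists>k\<in>?K. e k \<noteq> 0"
    "\<forall>a\<in>atoms T. (\<Sum>k\<in>?K. e k * (case k of None \<Rightarrow> c0 a | Some s \<Rightarrow> M s a)) = 0"
    using int_relation[OF finite_atoms, of ?K "\<lambda>k a. case k of None \<Rightarrow> c0 a | Some s \<Rightarrow> M s a"]
    by blast
  have e': "(\<Sum>s\<in>S. e (Some s) * M s a) = - (e None * c0 a)" if "a \<in> atoms T" for a
    using e(2) that assms(1) by (force simp: sum.reindex)
  have "(\<Sum>s\<in>S. e (Some s) * s i) = 0" for i
  proof -
    have "(\<Sum>s\<in>S. e (Some s) * s i) = (\<Sum>s\<in>S. \<Sum>a\<in>atoms T. e (Some s) * M s a * int (a i))"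
      by (intro sum.cong refl, subst M) (auto simp: sum_distrib_left mult.assoc)
    also have "\<dots> = (\<Sum>a\<in>atoms T. \<Sum>s\<in>S. e (Some s) * M s a * int (a i))" by (rule sum.swap)
    also have "\<dots> = (\<Sum>a\<in>atoms T. - e None * (c0 a * int (a i)))"
      by (intro sum.cong refl) (simp add: e' flip: sum_distrib_right)
    also have "\<dots> = 0" by (simp only: rel(2) mult_zero_right flip: sum_distrib_left)
    finally show ?thesis .
  qed
  then have S: "e (Some s) = 0" if "s \<in> S" for s
    using that assms(3)[unfolded z_indep_def, rule_format, of "\<lambda>s. e (Some s)"] by blast
  with e(1) have "e None \<noteq> 0" by auto
  with e' S rel(1) show False by force
qed

text \<open>These two facts make the \<open>Max\<close> in \<open>mrank\<close> meaningful.\<close>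

lemma mrank_set:
  "finite {card S | S. finite S \<and> S \<subseteq> zspan T \<and> z_indep S}"
  "{card S | S. finite S \<and> S \<subseteq> zspan T \<and> z_indep S} \<noteq> {}"
proof -
  show "finite {card S | S. finite S \<and> S \<subseteq> zspan T \<and> z_indep S}"
    by (rule finite_subset[of _ "{..card (atoms T)}"]) (use z_indep_card_le in auto)
  have "z_indep {}" by (simp add: z_indep_def)
  then show "{card S | S. finite S \<and> S \<subseteq> zspan T \<and> z_indep S} \<noteq> {}" by blast
qed

lemma mrank_attained:
  obtains S where "finite S" "S \<subseteq> zspan T" "z_indep S" "card S = mrank T"
proof -
  have "mrank T \<in> {card S | S. finite S \<and> S \<subseteq> zspan T \<and> z_indep S}"
    unfolding mrank_def by (rule Max_in[OF mrank_set])
  then show thesis using that by auto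
qed

lemma mrank_le: "mrank T \<le> card (atoms T)"
  using mrank_attained z_indep_card_le by metis

text \<open>The difference of two factorizations is a nontrivial integral relation between the
  atoms.\<close>

lemma mrank_less:
  assumes "is_fact T \<phi>" "is_fact T \<psi>" "fval T \<phi> = fval T \<psi>" "\<phi> \<noteq> \<psi>"
  shows "mrank T < card (atoms T)"
proof -
  obtain a where "\<phi> a \<noteq> \<psi> a" using assms(4) by blast
  then have 1: "\<exists>a\<in>atoms T. int (\<phi> a) - int (\<psi> a) \<noteq> 0"
    using assms(1,2) by (intro bexI[of _ a]) (auto simp: is_fact_def, metis)
  have 2: "(\<Sum>a\<in>atoms T. (int (\<phi> a) - int (\<psi> a)) * int (a i)) = 0" for i
    using fun_cong[OF assms(3), of i]
    by (simp add: fval_def left_diff_distrib sum_subtractf flip: of_nat_mult of_nat_sum)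
  show ?thesis using mrank_attained z_indep_card_less[OF _ _ _ 1 2] by metis
qed

lemma int_relation_trivial:
  fixes c :: "('i \<Rightarrow> nat) \<Rightarrow> int"
  assumes "J \<subseteq> atoms T" "indep (atoms T) coords J" "\<And>i. (\<Sum>a\<in>J. c a * int (a i)) = 0" "a \<in> J"
  shows "c a = 0"
proof -
  define d where "d = (\<lambda>a. if a \<in> J then real_of_int (c a) else 0)"
  have "in_kernel (atoms T) coords d"
    unfolding in_kernel_def
  proof (intro conjI allI impI)
    fix i
    have "(\<Sum>a\<in>atoms T. d a * coords a i) = (\<Sum>a\<in>J. real_of_int (c a * int (a i)))"
      by (intro sum.mono_neutral_cong_right) (use finite_atoms assms in \<open>auto simp: d_def\<close>)
    also have "\<dots> = 0" using assms(3) by (simp only: of_int_0 flip: of_int_sum)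
    finally show "(\<Sum>a\<in>atoms T. d a * coords a i) = 0" .
  qed (use assms in \<open>auto simp: d_def\<close>)
  then have "d a = 0" by (rule indepD[OF assms(2)]) (simp add: d_def)
  with assms(4) show ?thesis by (simp add: d_def)
qed

lemma indep_card_le_mrank:
  assumes "J \<subseteq> atoms T" "indep (atoms T) coords J"
  shows "card J \<le> mrank T"
proof -
  let ?e = "\<lambda>a::'i \<Rightarrow> nat. \<lambda>i. int (a i)"
  have inj: "inj_on ?e J" by (rule inj_onI) (metis ext of_nat_eq_iff)
  have fin: "finite J" using assms finite_atoms finite_subset by blast
  have "?e ` J \<subseteq> zspan T"
  proof
    fix v assume "v \<in> ?e ` J"
    then obtain a where "a \<in> T" "v = ?e a" using assms atoms_subset by blast
    then show "v \<in> zspan T" unfolding zspan_def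
      by (auto intro!: exI[of _ "{a}"] exI[of _ "\<lambda>_. 1"])
  qed
  moreover have "z_indep (?e ` J)"
    unfolding z_indep_def
  proof (intro allI impI ballI)
    fix c s assume c: "(\<lambda>i. \<Sum>s\<in>?e ` J. c s * s i) = (\<lambda>_. 0)" and "s \<in> ?e ` J"
    then obtain a where a: "a \<in> J" "s = ?e a" by blast
    have "(\<Sum>a\<in>J. c (?e a) * int (a i)) = 0" for i
      using fun_cong[OF c, of i] by (simp add: sum.reindex[OF inj])
    from int_relation_trivial[OF assms this a(1)] show "c s = 0" by (simp add: a(2))
  qed
  ultimately have "card (?e ` J) \<in> {card S | S. finite S \<and> S \<subseteq> zspan T \<and> z_indep S}"
    using fin by blast
  then show ?thesis unfolding mrank_def using mrank_set(1) by (metis (lifting) Max_ge card_image inj)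
qed

text \<open>More vectors than coordinates that they meet would satisfy an integral relation.\<close>

lemma indep_card_le_support:
  assumes "J \<subseteq> atoms T" "indep (atoms T) coords J"
  shows "card J \<le> card {i\<in>I. \<exists>a\<in>J. 0 < a i}"
proof (rule ccontr)
  assume neg: "\<not> ?thesis"
  have fin: "finite J" using assms finite_atoms finite_subset by blast
  obtain c where c: "\<exists>a\<in>J. c a \<noteq> 0" "\<forall>i\<in>{i\<in>I. \<exists>a\<in>J. 0 < a i}. (\<Sum>a\<in>J. c a * int (a i)) = 0"
    using int_relation[of "{i\<in>I. \<exists>a\<in>J. 0 < a i}" J "\<lambda>a i. int (a i)"] neg fin finite_I by auto
  have "(\<Sum>a\<in>J. c a * int (a i)) = 0" for i
  proof (cases "\<exists>a\<in>J. 0 < a i")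
    case True
    then have "i \<in> I" using vanish assms(1) atoms_subset by fastforce
    with True c(2) show ?thesis by blast
  next
    case False
    then show ?thesis by (intro sum.neutral) auto
  qed
  with int_relation_trivial[OF assms] c(1) show False by blast
qed

section \<open>The polytope of fractional factorizations\<close>

lemma feasible_small_deg:
  assumes q: "feasible (atoms T) coords (\<lambda>i. real (\<beta> i)) q" "\<And>a. a \<notin> F \<Longrightarrow> q a = 0"
    and F: "F \<subseteq> atoms T" and less: "\<And>a. q a < 1"
  shows "deg I \<beta> + card {i\<in>I. \<exists>a\<in>F. 0 < a i} \<le> (\<Sum>a\<in>F. deg I a)"
proof -
  let ?W = "{i\<in>I. \<exists>a\<in>F. 0 < a i}"
  have fin: "finite F" using F finite_atoms finite_subset by blast
  \<comment> \<open>Lowering all weights below 1 loses something at every index met by F, and by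
    integrality it loses at least 1.\<close>
  have le: "\<beta> i + (if i \<in> ?W then 1 else 0) \<le> (\<Sum>a\<in>F. a i)" if "i \<in> I" for i
  proof -
    have "real (\<beta> i) = (\<Sum>a\<in>atoms T. q a * real (a i))" using q(1) by (simp add: feasible_def)
    also have "\<dots> = (\<Sum>a\<in>F. q a * real (a i))"
      by (intro sum.mono_neutral_right finite_atoms F) (use q(2) in auto)
    finally have eq: "real (\<beta> i) = (\<Sum>a\<in>F. q a * real (a i))" .
    show ?thesis
    proof (cases "i \<in> ?W")
      case True
      then obtain b where b: "b \<in> F" "0 < b i" by blast
      have "real (\<beta> i) < (\<Sum>a\<in>F. real (a i))"
        unfolding eq
      proof (rule sum_strict_mono_ex1[OF fin])
        show "\<forall>a\<in>F. q a * real (a i) \<le> real (a i)"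
          using less by (simp add: less_imp_le mult_left_le_one_le q(1)[unfolded feasible_def])
        show "\<exists>a\<in>F. q a * real (a i) < real (a i)" using b less[of b] by (intro bexI[of _ b]) auto
      qed
      then have "\<beta> i < (\<Sum>a\<in>F. a i)" by (simp flip: of_nat_sum)
      with True show ?thesis by simp
    next
      case False
      with that have "real (\<beta> i) = 0" unfolding eq by (intro sum.neutral) auto
      with False show ?thesis by auto
    qed
  qed
  have "deg I \<beta> + card ?W = (\<Sum>i\<in>I. \<beta> i + (if i \<in> ?W then 1 else 0))"
    using finite_I by (simp add: deg_def sum.distrib flip: sum.inter_filter)
  also have "\<dots> \<le> (\<Sum>i\<in>I. \<Sum>a\<in>F. a i)" by (intro sum_mono le)
  also have "\<dots> = (\<Sum>a\<in>F. deg I a)" unfolding deg_def by (rule sum.swap)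
  finally show ?thesis .
qed

lemma fact_feasible:
  "is_fact T \<phi> \<Longrightarrow> feasible (atoms T) coords (\<lambda>i. real (fval T \<phi> i)) (\<lambda>a. real (\<phi> a))"
  by (auto simp: feasible_def is_fact_def fval_def)

lemma feasible_compatible:
  assumes q: "feasible (atoms T) coords (\<lambda>i. real (\<beta> i)) q" "1 \<le> q j" "1 \<le> q k" "j \<noteq> k"
  shows "compatible T \<beta> j k"
proof -
  have at: "j \<in> atoms T" "k \<in> atoms T" using q by (force simp: feasible_def)+
  have "j i + k i \<le> \<beta> i" for i
  proof -
    have "real (j i) + real (k i) \<le> q j * real (j i) + q k * real (k i)"
      using mult_right_mono[OF q(2), of "real (j i)"] mult_right_mono[OF q(3), of "real (k i)"] by simp
    also have "\<dots> = (\<Sum>a\<in>{j,k}. q a * real (a i))" using q(4) by simp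
    also have "\<dots> \<le> (\<Sum>a\<in>atoms T. q a * real (a i))"
      by (rule sum_mono2) (use at finite_atoms q(1) in \<open>auto simp: feasible_def\<close>)
    also have "\<dots> = real (\<beta> i)" using q(1) by (simp add: feasible_def)
    finally show ?thesis by linarith
  qed
  with at show ?thesis by (simp add: compatible_def)
qed

text \<open>The bound excludes a point of an edge with all weights below 1: its support F would give
  deg \<beta> + card F - 1 at most the sum of the degrees over F.\<close>

lemma connected_if_large:
  assumes \<beta>: "\<beta> \<in> T"
    and bound: "\<And>F. F \<subseteq> atoms T \<Longrightarrow> F \<noteq> {} \<Longrightarrow> card F \<le> mrank T + 1 \<Longrightarrow>
      (\<Sum>a\<in>F. deg I a) + 1 < deg I \<beta> + card F"
  shows "divisors_connected T \<beta>"
  unfolding divisors_connected_def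
proof (intro ballI impI, rule ccontr)
  fix a0 b0
  assume ab: "a0 \<in> atoms T" "b0 \<in> atoms T" "a0 \<le> \<beta>" "b0 \<le> \<beta>"
    and neg: "\<not> (compatible T \<beta>)\<^sup>*\<^sup>* a0 b0"
  \<comment> \<open>The complement of the component of \<open>a0\<close>. All atoms of \<phi> lie in
    that component, all atoms of \<psi> in C, so \<phi> and \<psi> serve as the two separated
    points.\<close>
  define C where "C = {c. \<not> (compatible T \<beta>)\<^sup>*\<^sup>* a0 c}"
  obtain \<phi> where \<phi>: "is_fact T \<phi>" "fval T \<phi> = \<beta>" "\<phi> a0 > 0" using fact_through \<beta> ab by metis
  obtain \<psi> where \<psi>: "is_fact T \<psi>" "fval T \<psi> = \<beta>" "\<psi> b0 > 0" using fact_through \<beta> ab by metis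
  show False
  proof (rule polyhedron_inseparable[of "atoms T" coords "\<lambda>i. real (\<beta> i)" C
        "\<lambda>a. real (\<phi> a)" "\<lambda>a. real (\<psi> a)"])
    show "feasible (atoms T) coords (\<lambda>i. real (\<beta> i)) (\<lambda>a. real (\<phi> a))"
      "feasible (atoms T) coords (\<lambda>i. real (\<beta> i)) (\<lambda>a. real (\<psi> a))"
      using fact_feasible[OF \<phi>(1)] fact_feasible[OF \<psi>(1)] \<phi> \<psi> by auto
    show "real (\<phi> k) = 0" if "k \<in> C" for k
      using fact_compatible_rtranclp[OF \<phi>(1,3), of k] that \<phi>(2) by (auto simp: C_def)
    show "real (\<psi> k) = 0" if "k \<notin> C" for k
    proof (rule ccontr)
      assume "real (\<psi> k) \<noteq> 0"
      then have "(compatible T \<beta>)\<^sup>*\<^sup>* k b0"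
        using fact_compatible_rtranclp[OF \<psi>(1) _ \<psi>(3), of k] \<psi>(2) by auto
      with that neg show False unfolding C_def by (auto dest: rtranclp_trans)
    qed
    show "k \<in> C" if q: "feasible (atoms T) coords (\<lambda>i. real (\<beta> i)) q" "1 \<le> q j" "1 \<le> q k" "j \<in> C"
      for q j k
    proof (rule ccontr)
      assume "k \<notin> C"
      then have "(compatible T \<beta>)\<^sup>*\<^sup>* a0 k" by (simp add: C_def)
      moreover have "j \<noteq> k" using \<open>k \<notin> C\<close> that by auto
      ultimately show False
        using feasible_compatible[OF q(1,3,2)] q(4)
        by (auto simp: C_def dest: rtranclp.rtrancl_into_rtrancl)
    qed
    show "\<exists>k. 1 \<le> q k" if q: "feasible (atoms T) coords (\<lambda>i. real (\<beta> i)) q"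
      and F: "\<And>k. k \<notin> F \<Longrightarrow> q k = 0" "F \<subseteq> atoms T" "indep (atoms T) coords (F - {f})" for q F f
    proof (rule ccontr)
      assume "\<not> ?thesis"
      then have less: "q k < 1" for k by (simp add: not_le)
      let ?W = "\<lambda>F. {i\<in>I. \<exists>a\<in>F. 0 < a i}"
      have deg: "deg I \<beta> + card (?W F) \<le> (\<Sum>a\<in>F. deg I a)"
        by (rule feasible_small_deg[OF q F(1,2) less])
      have fin: "finite F" using F(2) finite_atoms finite_subset by blast
      \<comment> \<open>Deleting f costs one atom: this gives both card F \<le> r + 1, as
        \<open>bound\<close> requires, and at least card F - 1 indices met by F.\<close>
      have "card F - 1 \<le> card (F - {f})" by (simp add: card_Diff_singleton_if)
      moreover have "card (F - {f}) \<le> mrank T"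
        by (rule indep_card_le_mrank) (use F in auto)
      moreover have "card (F - {f}) \<le> card (?W (F - {f}))"
        by (rule indep_card_le_support) (use F in auto)
      moreover have "card (?W (F - {f})) \<le> card (?W F)"
        by (rule card_mono) (use finite_I in auto)
      moreover have "F \<noteq> {}"
        using deg deg_mono[OF ab(3), of I] atom_deg_pos[OF ab(1)] by auto
      then have "0 < card F" using fin by (simp add: card_gt_0_iff)
      ultimately show False using bound[OF F(2) \<open>F \<noteq> {}\<close>] deg by linarith
    qed
  qed (rule finite_atoms)
qed

end

section \<open>Sorted degrees and the rank bound\<close>

lemma sum_le_sum_initial:
  fixes w :: "nat \<Rightarrow> nat"
  assumes anti: "\<And>i j. 1 \<le> i \<Longrightarrow> i \<le> j \<Longrightarrow> j \<le> n \<Longrightarrow> w j \<le> w i" and "K \<subseteq> {1..n}"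
  shows "sum w K \<le> (\<Sum>i=1..card K. w i)"
  using assms(2)
proof (induction "card K" arbitrary: K)
  case 0
  then show ?case using finite_subset[of K "{1..n}"] by auto
next
  case (Suc k)
  have fin: "finite K" using Suc.prems finite_subset by blast
  with Suc.hyps(2) have ne: "K \<noteq> {}" by auto
  define x where "x = Max K"
  have x: "x \<in> K" "K \<subseteq> {1..x}" using fin ne Suc.prems by (auto simp: x_def)
  \<comment> \<open>The largest of k + 1 positive indices is at least k + 1, so its weight is at
    most \<open>w (Suc k)\<close>; the rest is handled by induction.\<close>
  have "Suc k \<le> x" using card_mono[OF _ x(2)] Suc.hyps(2) by simp
  then have "w x \<le> w (Suc k)" using anti[of "Suc k" x] x Suc.prems by auto
  moreover have "sum w (K - {x}) \<le> (\<Sum>i=1..k. w i)"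
  proof -
    have k: "k = card (K - {x})" using Suc.hyps(2) x fin by simp
    show ?thesis unfolding k by (rule Suc.hyps(1)[OF k]) (use Suc.prems in auto)
  qed
  moreover have "sum w K = w x + sum w (K - {x})" using fin x by (simp add: sum.remove)
  ultimately show ?case using Suc.hyps(2)[symmetric] by simp
qed

context saturated_monoid
begin

text \<open>With unique factorization d = 0 works. Otherwise r < n and d is the sum of the r + 1
  largest degrees less r. Writing the rank on the left avoids truncated subtraction.\<close>

lemma chainable_rank_bound:
  assumes enum: "bij_betw a {1..n} (atoms T)"
    and sorted: "\<And>i j. 1 \<le> i \<Longrightarrow> i \<le> j \<Longrightarrow> j \<le> n \<Longrightarrow> deg I (a j) \<le> deg I (a i)"
  shows "\<exists>d. chainable I T d \<and> d + mrank T \<le> (\<Sum>i=1..min n (mrank T + 1). deg I (a i))"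
proof -
  define r where "r = mrank T"
  define w where "w = (\<lambda>i. deg I (a i))"
  have w1: "1 \<le> w i" if "i \<in> {1..n}" for i
    using atom_deg_pos[of "a i"] bij_betwE[OF enum] that by (simp add: w_def Suc_le_eq)
  have n: "card (atoms T) = n" using bij_betw_same_card[OF enum] by simp
  have wsum: "k \<le> l \<Longrightarrow> l \<le> n \<Longrightarrow> (\<Sum>i=1..k. w i) + (l - k) \<le> (\<Sum>i=1..l. w i)" for k l
  proof (induction l)
    case (Suc l)
    then show ?case using w1[of "Suc l"] by (cases "k = Suc l") auto
  qed simp
  have r_le: "r \<le> n" using mrank_le n by (simp add: r_def)
  show ?thesis
  proof (cases "\<forall>\<phi> \<psi>. is_fact T \<phi> \<longrightarrow> is_fact T \<psi> \<longrightarrow> fval T \<phi> = fval T \<psi> \<longrightarrow> \<phi> = \<psi>")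
    case True
    then have "chainable I T 0" by (intro chainableI) auto
    moreover have "r \<le> (\<Sum>i=1..min n (r + 1). w i)"
      using wsum[of 0 "min n (r + 1)"] r_le by simp
    ultimately show ?thesis by (auto simp: r_def w_def intro!: exI[of _ 0])
  next
    case False
    then have rn: "r + 1 \<le> n" using mrank_less n by (auto simp: r_def Suc_le_eq)
    define d where "d = (\<Sum>i=1..r+1. w i) - r"
    have d: "d + r = (\<Sum>i=1..r+1. w i)" using wsum[of 0 "r + 1"] rn by (simp add: d_def)
    have "chainable I T d"
    proof (intro chainable_if_connected connected_if_large)
      fix \<beta> F
      assume \<beta>: "\<beta> \<in> T" "d < deg I \<beta>" and F: "F \<subseteq> atoms T" "F \<noteq> {}" "card F \<le> mrank T + 1"
      define K where "K = {i\<in>{1..n}. a i \<in> F}"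
      have FK: "F = a ` K" using F(1) unfolding K_def bij_betw_imp_surj_on[OF enum, symmetric] by auto
      have inj: "inj_on a K" using enum by (auto simp: K_def bij_betw_def intro: inj_on_subset)
      have cK: "card K = card F" using FK inj card_image by metis
      have "(\<Sum>a\<in>F. deg I a) = sum w K" unfolding FK by (simp add: sum.reindex[OF inj] w_def)
      also have "\<dots> \<le> (\<Sum>i=1..card K. w i)"
        by (rule sum_le_sum_initial[of n]) (use sorted in \<open>auto simp: w_def K_def\<close>)
      \<comment> \<open>The sum over F is padded to r + 1 terms, each added degree being at least 1,
        so smaller sets F obey the same bound.\<close>
      finally have "(\<Sum>a\<in>F. deg I a) + (r + 1 - card F) \<le> d + r"
        using wsum[of "card K" "r + 1"] rn F(3) d by (simp add: cK r_def)
      with \<beta>(2) F(3) show "(\<Sum>a\<in>F. deg I a) + 1 < deg I \<beta> + card F" by (simp add: r_def)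
    qed auto
    moreover have "min n (r + 1) = r + 1" using rn by simp
    ultimately show ?thesis using d by (auto simp: r_def w_def)
  qed
qed

end

section \<open>Zero-sum sequences\<close>

lemma npow_0 [simp]: "npow 0 x = 0"
  by (simp add: npow_def)

lemma npow_Suc: "npow (Suc k) x = npow k x + x"
  by (simp add: npow_def lessThan_Suc add.commute)

lemma npow_add: "npow (j + k) x = npow j x + npow k x"
  by (induction k) (auto simp: npow_Suc add.assoc)

lemma npow_diff: "j \<le> k \<Longrightarrow> npow (k - j) x = npow k x - npow j x"
  using npow_add[of "k - j" j x] by simp

lemma npow_sum: "npow (sum f A) x = (\<Sum>i\<in>A. npow (f i) x)"
  by (induction A rule: infinite_finite_induct) (auto simp: npow_add)

lemma npow_torsion:
  assumes "finite (gen_subgroup S)" "x \<in> S"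
  shows "\<exists>k>0. npow k x = 0"
proof -
  have "npow k x \<in> gen_subgroup S" for k
    by (induction k) (auto simp: npow_Suc intro: gen_subgroup.intros assms(2))
  then have "finite (range (\<lambda>k. npow k x))" using assms(1) by (meson finite_subset image_subsetI)
  then have "\<not> inj (\<lambda>k. npow k x)" using finite_imageD by blast
  then obtain j k where "j < k" "npow j x = npow k x"
    unfolding inj_def by (metis linorder_neqE_nat)
  then have "npow (k - j) x = 0" "k - j > 0" by (auto simp: npow_diff)
  then show ?thesis by blast
qed

text \<open>Common form of \<open>Bseq\<close> and \<open>Bset\<close>; h may repeat values, and for
  \<open>Bset\<close> it is the identity.\<close>

definition zero_sum :: "'i set \<Rightarrow> ('i \<Rightarrow> 'a::ab_group_add) \<Rightarrow> ('i \<Rightarrow> nat) set" where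
  "zero_sum I h = {\<alpha>. (\<forall>i. i \<notin> I \<longrightarrow> \<alpha> i = 0) \<and> (\<Sum>i\<in>I. npow (\<alpha> i) (h i)) = 0}"

lemma Bset_eq_zero_sum: "Bset G0 = zero_sum G0 (\<lambda>x. x)"
  by (simp add: Bset_def zero_sum_def)

lemma Bseq_eq_zero_sum: "Bseq g m = zero_sum {..<m} g"
  by (simp add: Bseq_def zero_sum_def not_less)

text \<open>Saturation holds because a difference of zero sums in a group is a zero sum.\<close>

lemma saturated_zero_sum:
  assumes "finite I" "finite (atoms (zero_sum I h))"
  shows "saturated_monoid I (zero_sum I h)"
  by standard
    (use assms in \<open>auto simp: zero_sum_def npow_add sum.distrib npow_diff le_fun_def sum_subtractf\<close>)

section \<open>Transfer from a sequence to its support\<close>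

locale labelling =
  fixes I :: "'i set" and h :: "'i \<Rightarrow> 'a::ab_group_add"
  assumes finite_index: "finite I" and finite_base_atoms: "finite (atoms (Bset (h ` I)))"
begin

abbreviation Z where "Z \<equiv> zero_sum I h"
abbreviation B where "B \<equiv> Bset (h ` I)"

text \<open>Multiplicities are added over the fibres of h. This degree-preserving map restricts to a
  transfer homomorphism from \<open>Z\<close> to \<open>B\<close>.\<close>

definition push :: "('i \<Rightarrow> nat) \<Rightarrow> 'a \<Rightarrow> nat" where
  "push \<alpha> x = (\<Sum>i\<in>{i\<in>I. h i = x}. \<alpha> i)"

sublocale base: saturated_monoid "h ` I" B
  unfolding Bset_eq_zero_sum
  by (rule saturated_zero_sum) (use finite_index finite_base_atoms Bset_eq_zero_sum[of "h ` I"] in auto)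

lemma push_outside: "x \<notin> h ` I \<Longrightarrow> push \<alpha> x = 0"
  by (auto simp: push_def intro!: sum.neutral)

lemma deg_push: "deg (h ` I) (push \<alpha>) = deg I \<alpha>"
  unfolding deg_def push_def by (rule sum.image_gen[OF finite_index, symmetric])

lemma push_mem: "(\<And>i. i \<notin> I \<Longrightarrow> \<alpha> i = 0) \<Longrightarrow> \<alpha> \<in> Z \<longleftrightarrow> push \<alpha> \<in> B"
proof -
  have "(\<Sum>i\<in>I. npow (\<alpha> i) (h i)) = (\<Sum>x\<in>h ` I. \<Sum>i\<in>{i\<in>I. h i = x}. npow (\<alpha> i) (h i))"
    by (rule sum.image_gen[OF finite_index])
  also have "\<dots> = (\<Sum>x\<in>h ` I. npow (push \<alpha> x) x)"
    by (intro sum.cong refl) (auto simp: push_def npow_sum)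
  finally show "(\<And>i. i \<notin> I \<Longrightarrow> \<alpha> i = 0) \<Longrightarrow> \<alpha> \<in> Z \<longleftrightarrow> push \<alpha> \<in> B"
    by (auto simp: zero_sum_def Bset_def push_outside)
qed

lemma Z_vanish: "\<alpha> \<in> Z \<Longrightarrow> i \<notin> I \<Longrightarrow> \<alpha> i = 0"
  by (auto simp: zero_sum_def)

lemma push_mem_B: "\<alpha> \<in> Z \<Longrightarrow> push \<alpha> \<in> B"
  using push_mem Z_vanish by blast

lemma push_add: "push (\<lambda>i. \<alpha> i + \<gamma> i) x = push \<alpha> x + push \<gamma> x"
  by (simp add: push_def sum.distrib)

lemma push_diff: "\<alpha> \<le> \<gamma> \<Longrightarrow> push (\<lambda>i. \<gamma> i - \<alpha> i) x = push \<gamma> x - push \<alpha> x"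
  by (simp add: push_def le_fun_def sum_subtractf_nat)

lemma push_mono: "\<alpha> \<le> \<gamma> \<Longrightarrow> push \<alpha> \<le> push \<gamma>"
  by (auto simp: push_def le_fun_def intro: sum_mono)

lemma push_eq_0: "(\<And>i. i \<notin> I \<Longrightarrow> \<alpha> i = 0) \<Longrightarrow> push \<alpha> = (\<lambda>_. 0) \<Longrightarrow> \<alpha> = (\<lambda>_. 0)"
proof (rule ext)
  fix i assume 0: "\<And>i. i \<notin> I \<Longrightarrow> \<alpha> i = 0" "push \<alpha> = (\<lambda>_. 0)"
  have "push \<alpha> (h i) = 0" using 0 by simp
  with 0(1) show "\<alpha> i = 0" using finite_index by (cases "i \<in> I") (auto simp: push_def)
qed

text \<open>Units are removed one at a time from fibres where the image still exceeds
  \<gamma>.\<close>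

lemma push_lift:
  assumes "\<And>i. i \<notin> I \<Longrightarrow> \<alpha> i = 0" "\<gamma> \<le> push \<alpha>"
  shows "\<exists>\<alpha>'\<le>\<alpha>. push \<alpha>' = \<gamma>"
  using assms
proof (induction "deg I \<alpha>" arbitrary: \<alpha> rule: less_induct)
  case less
  show ?case
  proof (cases "push \<alpha> = \<gamma>")
    case False
    then obtain x where x: "\<gamma> x < push \<alpha> x"
      using less.prems(2) by (metis ext le_funD le_neq_implies_less)
    then have "push \<alpha> x \<noteq> 0" by simp
    then obtain i where i: "i \<in> I" "h i = x" "\<alpha> i > 0"
      using finite_index by (auto simp: push_def)
    let ?e = "\<lambda>j. if j = i then 1 else 0 :: nat"
    let ?\<alpha> = "\<lambda>j. \<alpha> j - ?e j"
    have le: "?e \<le> \<alpha>" using i by (auto simp: le_fun_def)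
    have e: "push ?e y = (if y = x then 1 else 0)" for y
      using i finite_index by (simp add: push_def)
    have "deg I ?\<alpha> < deg I \<alpha>"
      unfolding deg_def by (rule sum_strict_mono_ex1[OF finite_index]) (use i in auto)
    moreover have "\<gamma> \<le> push ?\<alpha>"
    proof (rule le_funI)
      fix y show "\<gamma> y \<le> push ?\<alpha> y"
        using push_diff[OF le, of y] e[of y] le_funD[OF less.prems(2), of y] x by auto
    qed
    ultimately obtain \<alpha>' where "\<alpha>' \<le> ?\<alpha>" "push \<alpha>' = \<gamma>"
      using less.hyps[of ?\<alpha>] less.prems(1) by auto
    moreover have "?\<alpha> \<le> \<alpha>" by (auto simp: le_fun_def)
    ultimately show ?thesis using order_trans by blast
  qed auto
qed

lemma push_nonzero: "\<alpha> \<in> Z \<Longrightarrow> \<alpha> \<noteq> (\<lambda>_. 0) \<Longrightarrow> push \<alpha> \<noteq> (\<lambda>_. 0)"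
  using push_eq_0 Z_vanish by blast

text \<open>A splitting of \<open>push a\<close> lifts to one of a, and membership in
  \<open>Z\<close> can be tested on the image.\<close>

lemma push_atom:
  assumes "a \<in> atoms Z" shows "push a \<in> atoms B"
  unfolding atoms_def
proof (safe)
  have aZ: "a \<in> Z" "a \<noteq> (\<lambda>_. 0)" using assms atoms_subset atom_nonzero by blast+
  then show "push a \<in> B" by (simp add: push_mem_B)
  show False if "push a = (\<lambda>_. 0)" using push_nonzero[OF aZ] that by blast
  fix b c assume bc: "b \<in> B" "c \<in> B" "push a = (\<lambda>i. b i + c i)" "c \<noteq> (\<lambda>_. 0)"
  have "b \<le> push a" using bc by (auto simp: le_fun_def)
  then obtain b' where b': "b' \<le> a" "push b' = b" using push_lift Z_vanish aZ(1) by blast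
  let ?c = "\<lambda>i. a i - b' i"
  have c': "push ?c = c" using push_diff[OF b'(1)] b'(2) bc(3) by auto
  have supp: "i \<notin> I \<Longrightarrow> b' i = 0" "i \<notin> I \<Longrightarrow> ?c i = 0" for i
    using le_funD[OF b'(1), of i] Z_vanish[OF aZ(1), of i] by auto
  have "b' \<in> Z" "?c \<in> Z" using push_mem supp b' c' bc by auto
  moreover have "a = (\<lambda>i. b' i + ?c i)" using b'(1) by (auto simp: le_fun_def)
  ultimately have "b' = (\<lambda>_. 0) \<or> ?c = (\<lambda>_. 0)" using assms unfolding atoms_def by blast
  moreover have "?c \<noteq> (\<lambda>_. 0)" using c' bc(4) by (auto simp: push_def)
  ultimately show "b = (\<lambda>_. 0)" using b'(2) by (auto simp: push_def)
qed

lemma atom_if_push_atom: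
  assumes "\<And>i. i \<notin> I \<Longrightarrow> a i = 0" "push a \<in> atoms B"
  shows "a \<in> atoms Z"
  unfolding atoms_def
proof (safe)
  show "a \<in> Z" using assms push_mem atoms_subset by blast
  show False if "a = (\<lambda>_. 0)" using atom_nonzero[OF assms(2)] that by (auto simp: push_def)
  fix b c assume bc: "b \<in> Z" "c \<in> Z" "a = (\<lambda>i. b i + c i)" "c \<noteq> (\<lambda>_. 0)"
  have "push a = (\<lambda>x. push b x + push c x)" unfolding bc(3) using push_add by blast
  then have "push b = (\<lambda>_. 0) \<or> push c = (\<lambda>_. 0)"
    using assms(2) push_mem_B[OF bc(1)] push_mem_B[OF bc(2)] unfolding atoms_def by blast
  then show "b = (\<lambda>_. 0)" using push_nonzero bc by blast
qed

text \<open>Atoms go to atoms of the same degree, so their degrees are bounded by those of the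
  finitely many atoms of \<open>B\<close>.\<close>

lemma finite_atoms_Z: "finite (atoms Z)"
proof (rule finite_subset)
  define D where "D = Max (deg (h ` I) ` atoms B)"
  show "atoms Z \<subseteq> {\<alpha>. (\<forall>i. i \<notin> I \<longrightarrow> \<alpha> i = 0) \<and> deg I \<alpha> \<le> D}"
  proof
    fix a assume a: "a \<in> atoms Z"
    have "deg (h ` I) (push a) \<le> D"
      unfolding D_def by (rule Max_ge) (use finite_base_atoms push_atom[OF a] in auto)
    moreover have "a \<in> Z" using a atoms_subset by blast
    ultimately show "a \<in> {\<alpha>. (\<forall>i. i \<notin> I \<longrightarrow> \<alpha> i = 0) \<and> deg I \<alpha> \<le> D}"
      using Z_vanish by (auto simp: deg_push)
  qed
qed (rule finite_bounded_deg[OF finite_index])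

sublocale saturated_monoid I Z
  by (rule saturated_zero_sum[OF finite_index finite_atoms_Z])

text \<open>The next atom of the path is at most push \<beta> - push a' = push (\<beta> - a'), so it
  lifts below \<beta> - a' and the lift is compatible with a'.\<close>

lemma lift_path:
  assumes "\<beta> \<in> Z" "a \<in> atoms Z" "a \<le> \<beta>" "(compatible B (push \<beta>))\<^sup>*\<^sup>* (push a) c"
  shows "\<exists>a'\<in>atoms Z. a' \<le> \<beta> \<and> push a' = c \<and> (compatible Z \<beta>)\<^sup>*\<^sup>* a a'"
  using assms(4)
proof (induction rule: rtranclp_induct)
  case base
  then show ?case using assms by blast
next
  case (step c c')
  obtain a' where a': "a' \<in> atoms Z" "a' \<le> \<beta>" "push a' = c" "(compatible Z \<beta>)\<^sup>*\<^sup>* a a'"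
    using step.IH by blast
  have c': "c' \<in> atoms B" "c x + c' x \<le> push \<beta> x" for x
    using step.hyps(2) by (auto simp: compatible_def)
  have cle: "c' \<le> push (\<lambda>i. \<beta> i - a' i)"
  proof (rule le_funI)
    fix x show "c' x \<le> push (\<lambda>i. \<beta> i - a' i) x"
      using push_diff[OF a'(2), of x] a'(3) c'(2)[of x] by simp
  qed
  have z: "i \<notin> I \<Longrightarrow> \<beta> i - a' i = 0" for i using Z_vanish[OF assms(1)] by auto
  from push_lift[OF z cle] obtain b where b: "b \<le> (\<lambda>i. \<beta> i - a' i)" "push b = c'" by auto
  have b0: "i \<notin> I \<Longrightarrow> b i = 0" for i using le_funD[OF b(1), of i] z[of i] by simp
  have bat: "b \<in> atoms Z" using atom_if_push_atom[of b] b0 b(2) c'(1) by blast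
  have le: "a' i + b i \<le> \<beta> i" for i
    using le_funD[OF b(1), of i] le_funD[OF a'(2), of i] by linarith
  have "b \<le> \<beta>" using add_leD2[OF le] by (simp add: le_fun_def)
  moreover have "(compatible Z \<beta>)\<^sup>*\<^sup>* a b"
  proof (rule rtranclp.rtrancl_into_rtrancl[OF a'(4)])
    show "compatible Z \<beta> a' b" using a'(1) bat le by (simp add: compatible_def)
  qed
  ultimately show ?case using bat b(2) by blast
qed

text \<open>Moving one unit inside a fibre of \<open>h\<close>, from \<open>j\<close> to \<open>i\<close>, changes \<open>a\<close> to an atom \<open>a'\<close>. As
  \<open>\<beta> - a\<close> is too large to be an atom, one of its atoms does not use a prescribed unit at \<open>i\<close>;
  it is compatible with both \<open>a\<close> and \<open>a'\<close>.\<close>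

lemma same_push_path:
  assumes \<beta>: "\<beta> \<in> Z" "2 * D < deg I \<beta>" and D: "\<And>a. a \<in> atoms Z \<Longrightarrow> deg I a \<le> D"
    and "a \<in> atoms Z" "b \<in> atoms Z" "a \<le> \<beta>" "b \<le> \<beta>" "push a = push b"
  shows "(compatible Z \<beta>)\<^sup>*\<^sup>* a b"
  using assms(4-)
proof (induction "deg I (\<lambda>i. b i - a i)" arbitrary: a rule: less_induct)
  case less
  note a = less.prems(1,3,5)
  have aZ: "a \<in> Z" "b \<in> Z" using less.prems atoms_subset by blast+
  show ?case
  proof (cases "b \<le> a")
    case True
    then have "b = a" using atom_le_atom less.prems by blast
    then show ?thesis by simp
  next
    case False
    then obtain i where i: "a i < b i" by (auto simp: le_fun_def not_le)
    then have iI: "i \<in> I" using Z_vanish[OF aZ(2), of i] by force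
    \<comment> \<open>Equal fibre sums: an excess of b at i is balanced by an excess of a elsewhere
      in the fibre.\<close>
    have "\<exists>j\<in>{j\<in>I. h j = h i}. b j < a j"
    proof (rule ccontr)
      assume "\<not> ?thesis"
      then have "push a (h i) < push b (h i)"
        unfolding push_def using i iI finite_index by (intro sum_strict_mono_ex1) (auto simp: not_less)
      with a(3) show False by simp
    qed
    then obtain j where j: "j \<in> I" "h j = h i" "b j < a j" by blast
    have ij: "i \<noteq> j" using i j by auto
    define a' where "a' = (\<lambda>k. if k = i then a k + 1 else if k = j then a k - 1 else a k)"
    have a'I: "k \<notin> I \<Longrightarrow> a' k = 0" for k using iI j Z_vanish[OF aZ(1)] by (auto simp: a'_def)
    have pa': "push a' = push a"
    proof (rule ext)
      fix x
      \<comment> \<open>Units are added on both sides instead of subtracted, to stay clear of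
        truncation.\<close>
      have "push (\<lambda>k. a' k + (if k = j then 1 else 0)) x = push (\<lambda>k. a k + (if k = i then 1 else 0)) x"
        by (rule arg_cong[where f = "\<lambda>u. push u x"]) (use ij j in \<open>auto simp: a'_def\<close>)
      moreover have "push (\<lambda>k. if k = j then 1 else 0) x = push (\<lambda>k. if k = i then 1 else 0) x"
        using j iI finite_index by (auto simp: push_def)
      ultimately show "push a' x = push a x" unfolding push_add by simp
    qed
    have a'at: "a' \<in> atoms Z" using atom_if_push_atom[OF a'I] pa' push_atom[OF a(1)] by simp
    have a'le: "a' \<le> \<beta>"
    proof (rule le_funI)
      fix k show "a' k \<le> \<beta> k"
        using le_funD[OF a(2), of k] le_funD[OF less.prems(4), of k] i j by (auto simp: a'_def)
    qed
    let ?d = "\<lambda>k. \<beta> k - a k"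
    have dZ: "?d \<in> Z" using diff_mem[OF aZ(1) \<beta>(1) a(2)] .
    have di: "0 < ?d i" using i le_funD[OF less.prems(4), of i] by simp
    obtain c1 where c1: "c1 \<in> atoms Z" "c1 \<le> ?d" "c1 i > 0" by (rule atom_below_at[OF dZ di])
    let ?d' = "\<lambda>k. ?d k - c1 k"
    have d'Z: "?d' \<in> Z" using diff_mem[OF _ dZ c1(2)] c1(1) atoms_subset by blast
    have "deg I ?d' = deg I \<beta> - deg I a - deg I c1"
      using deg_diff[OF c1(2), of I] deg_diff[OF a(2), of I] by simp
    then have "0 < deg I ?d'" using \<beta>(2) D[OF a(1)] D[OF c1(1)] by linarith
    moreover have "deg I (\<lambda>_. 0) = 0" by (simp add: deg_def)
    ultimately have "?d' \<noteq> (\<lambda>_. 0)" by (metis less_irrefl)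
    then obtain c where c: "c \<in> atoms Z" "c \<le> ?d'" by (rule atom_below[OF d'Z])
    have "a k + c k \<le> \<beta> k \<and> c k + a' k \<le> \<beta> k" for k
      using le_funD[OF c(2), of k] le_funD[OF c1(2), of k] le_funD[OF a(2), of k]
        le_funD[OF a'le, of k] c1(3) di
      by (auto simp: a'_def)
    then have "compatible Z \<beta> a c" "compatible Z \<beta> c a'"
      using a(1) c(1) a'at by (auto simp: compatible_def)
    then have "(compatible Z \<beta>)\<^sup>*\<^sup>* a a'" by (meson r_into_rtranclp rtranclp.rtrancl_into_rtrancl)
    moreover have "(compatible Z \<beta>)\<^sup>*\<^sup>* a' b"
    proof (rule less.hyps)
      \<comment> \<open>The truncated difference drops by one at i and stays 0 at j, where a
        exceeded b.\<close>
      show "deg I (\<lambda>k. b k - a' k) < deg I (\<lambda>k. b k - a k)"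
        unfolding deg_def
        by (rule sum_strict_mono_ex1[OF finite_index]) (use i iI j in \<open>auto simp: a'_def intro!: bexI[of _ i]\<close>)
    qed (use a'at a'le pa' less.prems in auto)
    ultimately show ?thesis by simp
  qed
qed

text \<open>Degree above d gives a path from \<open>push a\<close> to \<open>push b\<close>, whose
  lift ends at some a' over \<open>push b\<close>; degree above 2D links a' to b.\<close>

lemma chainable_max:
  assumes ch: "chainable (h ` I) B d" and D: "\<And>a. a \<in> atoms B \<Longrightarrow> deg (h ` I) a \<le> D"
  shows "chainable I Z (max (2 * D) d)"
proof (rule chainable_if_connected)
  fix \<beta> assume \<beta>: "\<beta> \<in> Z" "max (2 * D) d < deg I \<beta>"
  show "divisors_connected Z \<beta>"
    unfolding divisors_connected_def
  proof (intro ballI impI)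
    fix a b assume ab: "a \<in> atoms Z" "b \<in> atoms Z" "a \<le> \<beta>" "b \<le> \<beta>"
    have "divisors_connected B (push \<beta>)"
      by (rule base.connected_if_chainable[OF ch push_mem_B]) (use \<beta> in \<open>auto simp: deg_push\<close>)
    then have "(compatible B (push \<beta>))\<^sup>*\<^sup>* (push a) (push b)"
      using push_atom push_mono ab unfolding divisors_connected_def by blast
    then obtain a' where a': "a' \<in> atoms Z" "a' \<le> \<beta>" "push a' = push b" "(compatible Z \<beta>)\<^sup>*\<^sup>* a a'"
      using lift_path[OF \<beta>(1) ab(1,3)] by blast
    have "(compatible Z \<beta>)\<^sup>*\<^sup>* a' b"
      by (rule same_push_path[of _ D]) (use \<beta> ab a' D[OF push_atom] in \<open>auto simp: deg_push\<close>)
    with a'(4) show "(compatible Z \<beta>)\<^sup>*\<^sup>* a b" by simp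
  qed
qed

section \<open>The little Davenport constant\<close>

lemma davenport_dominating:
  assumes fin: "finite (gen_subgroup (h ` I))"
    and \<alpha>: "\<And>x. x \<notin> h ` I \<Longrightarrow> \<alpha> x = 0" "davenport (h ` I) < deg (h ` I) \<alpha>"
  shows "\<exists>c\<in>atoms B. c \<le> \<alpha>"
proof (rule ccontr)
  let ?S = "h ` I"
  let ?free = "\<lambda>\<alpha>. (\<forall>x. x \<notin> ?S \<longrightarrow> \<alpha> x = 0) \<and> (\<forall>\<gamma>\<in>atoms B. \<exists>x\<in>?S. \<alpha> x < \<gamma> x)"
  assume neg: "\<not> ?thesis"
  obtain k where k: "\<And>x. x \<in> ?S \<Longrightarrow> k x > 0 \<and> npow (k x) x = 0" using npow_torsion[OF fin] by metis
  \<comment> \<open>The sequence of \<open>k x\<close> copies of x sums to zero and contains an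
    atom, which \<alpha> must fail to dominate. The set under \<open>Max\<close> in
    \<open>davenport\<close> is thereby finite.\<close>
  have bound: "\<alpha> x \<le> k x" if \<alpha>: "?free \<alpha>" and x: "x \<in> ?S" for \<alpha> x
  proof -
    let ?e = "\<lambda>y. if y = x then k x else 0"
    have "(\<Sum>y\<in>?S. npow (?e y) y) = (\<Sum>y\<in>?S. if y = x then npow (k x) x else 0)"
      by (intro sum.cong) auto
    then have "?e \<in> B" using k[OF x] x finite_index by (auto simp: Bset_def)
    moreover have "?e \<noteq> (\<lambda>_. 0)" using k[OF x] by (metis less_irrefl)
    ultimately obtain c where c: "c \<in> atoms B" "c \<le> ?e" by (rule base.atom_below)
    then obtain y where "\<alpha> y < c y" using \<alpha> by blast
    with le_funD[OF c(2), of y] show ?thesis by (cases "y = x") auto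
  qed
  have "finite {deg ?S \<alpha> | \<alpha>. ?free \<alpha>}"
  proof (rule finite_subset)
    show "{deg ?S \<alpha> | \<alpha>. ?free \<alpha>} \<subseteq> {..\<Sum>x\<in>?S. k x}"
      using bound by (auto simp: deg_def intro!: sum_mono)
  qed simp
  moreover have "?free \<alpha>"
  proof (intro conjI allI impI ballI)
    fix \<gamma> assume \<gamma>: "\<gamma> \<in> atoms B"
    then obtain x where x: "\<alpha> x < \<gamma> x" using neg by (auto simp: le_fun_def not_le)
    then have "x \<in> ?S" using base.vanish \<gamma> atoms_subset by fastforce
    with x show "\<exists>x\<in>?S. \<alpha> x < \<gamma> x" by blast
  qed (rule \<alpha>(1))
  ultimately have "deg ?S \<alpha> \<le> davenport ?S" unfolding davenport_def by (intro Max_ge) auto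
  with \<alpha>(2) show False by simp
qed

lemma chainable_davenport:
  assumes fin: "finite (gen_subgroup (h ` I))"
  shows "chainable I Z (2 * davenport (h ` I) + 2)"
proof (rule chainable_if_connected)
  fix \<beta> assume \<beta>: "\<beta> \<in> Z" "2 * davenport (h ` I) + 2 < deg I \<beta>"
  show "divisors_connected Z \<beta>"
  \<comment> \<open>Exceeding the Davenport constant by one guarantees an atom, and twice this
    number is the claimed bound.\<close>
  proof (rule connected_if_dominating[of "davenport (h ` I) + 1"])
    fix \<alpha> assume \<alpha>: "\<And>i. i \<notin> I \<Longrightarrow> \<alpha> i = 0" "davenport (h ` I) + 1 \<le> deg I \<alpha>"
    then obtain c where c: "c \<in> atoms B" "c \<le> push \<alpha>"
      using davenport_dominating[OF fin, of "push \<alpha>"] push_outside by (auto simp: deg_push)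
    obtain c' where c': "c' \<le> \<alpha>" "push c' = c" using push_lift[OF \<alpha>(1) c(2)] by blast
    have "i \<notin> I \<Longrightarrow> c' i = 0" for i using le_funD[OF c'(1), of i] \<alpha>(1)[of i] by simp
    then show "\<exists>c\<in>atoms Z. c \<le> \<alpha>" using atom_if_push_atom c' c(1) by blast
  qed (use \<beta> in auto)
qed

end

theorem theorem6p2:
  fixes g :: "nat \<Rightarrow> 'a::ab_group_add" and m n :: nat and a :: "nat \<Rightarrow> ('a \<Rightarrow> nat)"
  defines "S \<equiv> g ` {..<m}"
  defines "r \<equiv> mrank (Bset S)"
  assumes enum: "bij_betw a {1..n} (atoms (Bset S))"
    and sorted: "\<forall>i j. 1 \<le> i \<longrightarrow> i \<le> j \<longrightarrow> j \<le> n \<longrightarrow> deg S (a j) \<le> deg S (a i)"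
  shows "(cgr {..<m} (Bseq g m) \<le> max (2 * deg S (a 1)) (cgr S (Bset S))
          \<and> int (cgr S (Bset S)) \<le> (\<Sum>i=1..min n (r + 1). int (deg S (a i))) - int r)
       \<and> (finite (gen_subgroup S) \<longrightarrow> cgr {..<m} (Bseq g m) \<le> 2 * davenport S + 2)"
proof -
  have "finite (atoms (Bset S))" using bij_betw_finite[OF enum] by simp
  then interpret labelling "{..<m}" g by unfold_locales (simp_all add: S_def)
  obtain d where d: "chainable S (Bset S) d" "d + r \<le> (\<Sum>i=1..min n (r + 1). deg S (a i))"
    using base.chainable_rank_bound[of a n] enum sorted unfolding r_def S_def by blast
  \<comment> \<open>For n = 0 the value \<open>a 1\<close> is arbitrary, but then there is no atom c
    to compare.\<close>
  have "deg S c \<le> deg S (a 1)" if c: "c \<in> atoms (Bset S)" for c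
  proof -
    obtain i where "i \<in> {1..n}" "c = a i" using bij_betw_imp_surj_on[OF enum] c by blast
    then show ?thesis using sorted by simp
  qed
  \<comment> \<open>The rank bound d is what certifies that \<open>cgr S (Bset S)\<close> is itself
    chainable.\<close>
  then have "chainable {..<m} (Bseq g m) (max (2 * deg S (a 1)) (cgr S (Bset S)))"
    using chainable_max chainable_cgr[OF d(1)] unfolding Bseq_eq_zero_sum S_def by blast
  then have "cgr {..<m} (Bseq g m) \<le> max (2 * deg S (a 1)) (cgr S (Bset S))" by (rule cgr_le)
  moreover have "int (cgr S (Bset S)) \<le> (\<Sum>i=1..min n (r + 1). int (deg S (a i))) - int r"
    using cgr_le[OF d(1)] d(2) by (simp flip: of_nat_sum)
  moreover have "cgr {..<m} (Bseq g m) \<le> 2 * davenport S + 2" if "finite (gen_subgroup S)"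
    using chainable_davenport that unfolding Bseq_eq_zero_sum S_def by (intro cgr_le) blast
  ultimately show ?thesis by blast
qed

end
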